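(* Let $(R,\mathfrak m)$ be a (Noetherian) complete local domain of dimension $d>0$ and mixed characteristic $(0,p)$, let $T$ be a $p$-torsion free $R$-algebra, and let $\pi\in T$ be a non-zerodivisor such that $T$ contains a compatible system $\pi^{1/p^\infty}=\{\pi^{1/p^n}\}_{n\geq 1}$ of $p$-power roots of $\pi$. Suppose that $T$ is an almost big Cohen-Macaulay algebra over $R$ with respect to $\pi^{1/p^\infty}$. For $R$-modules $N\subseteq M$ and $u\in M$, let $u\in N_M^{\mathrm{cl}}$ if for all $n>0$, $\pi^{1/p^n}\otimes u\in\operatorname{Im}(T\otimes_R N\to T\otimes_R M)$. Then $$\tau_{\mathrm{cl}}(R)=\operatorname{tr}_{\mathrm{cl}}(R),\qquad\text{where}\quad \operatorname{tr}_{\mathrm{cl}}(R)=\sum_{n>0}\ \sum_{\psi\in\operatorname{Hom}_R(T,R)}\psi(\pi^{1/p^n}T).$$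
   Context: Compatible system of $p$-power roots: elements $\pi^{1/p^n}\in T$ with $(\pi^{1/p^n})^{p^m}=\pi^{1/p^{n-m}}$ for all $m\le n$ (with $\pi^{1/p^0}=\pi$). $T$ is an almost (balanced) big Cohen-Macaulay algebra with respect to $\pi^{1/p^\infty}$ if $T/\mathfrak mT$ is not almost zero (it is not the case that $\pi^{1/p^n}(T/\mathfrak mT)=0$ for all $n>0$), and for every system of parameters $x_1,\dots,x_d$ of $R$, $\pi^{1/p^n}\cdot\frac{(x_1,\dots,x_i)T:_T x_{i+1}}{(x_1,\dots,x_i)T}=0$ for all $n>0$ and $0\le i\le d-1$. The test ideal is $\tau_{\mathrm{cl}}(R)=\bigcap_{N\subseteq M}(N:_R N_M^{\mathrm{cl}})$ over all (not necessarily finitely generated) $R$-modules $N\subseteq M$. *)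

theory Defs
  imports "HOL-Algebra.Algebra" "HOL-Library.Extended_Nat" "HOL-Computational_Algebra.Primes"
begin

section \<open>Complete local rings of mixed characteristic\<close>

definition local_ring :: "('a, 'b) ring_scheme \<Rightarrow> 'a set \<Rightarrow> bool"
  where "local_ring R \<mm> \<longleftrightarrow>
    cring R \<and> maximalideal \<mm> R \<and> (\<forall>J. maximalideal J R \<longrightarrow> J = \<mm>)"

text \<open>Powers of an ideal are powers in the monoid \<^const>\<open>ideals_set\<close>, whose unit is the whole
  ring. A sequence \<open>s\<close> as below is a family of representatives of an element of the inverse limit
  of the rings \<open>R/\<mm>\<^sup>k\<close>, so the condition says that \<open>R\<close> maps bijectively onto this limit.\<close>

definition adically_complete :: "('a, 'b) ring_scheme \<Rightarrow> 'a set \<Rightarrow> bool"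
  where "adically_complete R \<mm> \<longleftrightarrow>
    (\<forall>s :: nat \<Rightarrow> 'a.
       (\<forall>k. s k \<in> carrier R) \<and>
       (\<forall>k. s (Suc k) \<ominus>\<^bsub>R\<^esub> s k \<in> \<mm> [^]\<^bsub>ideals_set R\<^esub> k)
       \<longrightarrow> (\<exists>!a. a \<in> carrier R \<and> (\<forall>k. a \<ominus>\<^bsub>R\<^esub> s k \<in> \<mm> [^]\<^bsub>ideals_set R\<^esub> k)))"

definition krull_dim :: "('a, 'b) ring_scheme \<Rightarrow> enat"
  where "krull_dim R = Sup {enat n | n (P :: nat \<Rightarrow> 'a set).
    (\<forall>i\<le>n. primeideal (P i) R) \<and> (\<forall>i<n. P i \<subset> P (Suc i))}"

definition has_char :: "('a, 'b) ring_scheme \<Rightarrow> nat \<Rightarrow> bool"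
  where "has_char R n \<longleftrightarrow> (\<forall>k::nat. [k] \<cdot>\<^bsub>R\<^esub> \<one>\<^bsub>R\<^esub> = \<zero>\<^bsub>R\<^esub> \<longleftrightarrow> n dvd k)"

definition mixed_char :: "('a, 'b) ring_scheme \<Rightarrow> 'a set \<Rightarrow> nat \<Rightarrow> bool"
  where "mixed_char R \<mm> p \<longleftrightarrow> Factorial_Ring.prime p \<and> has_char R 0 \<and> has_char (R Quot \<mm>) p"

definition ideal_radical :: "('a, 'b) ring_scheme \<Rightarrow> 'a set \<Rightarrow> 'a set"
  where "ideal_radical R I = {a \<in> carrier R. \<exists>n::nat. a [^]\<^bsub>R\<^esub> n \<in> I}"

text \<open>Meant for a local ring \<open>(R, \<mm>)\<close>: \<open>dim R\<close> many elements generating an \<open>\<mm>\<close>-primary ideal.\<close>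

definition system_of_parameters :: "('a, 'b) ring_scheme \<Rightarrow> 'a set \<Rightarrow> 'a list \<Rightarrow> bool"
  where "system_of_parameters R \<mm> xs \<longleftrightarrow>
    enat (length xs) = krull_dim R \<and> set xs \<subseteq> \<mm> \<and>
    ideal_radical R (Idl\<^bsub>R\<^esub> (set xs)) = \<mm>"


section \<open>Algebras and $p$-power roots\<close>

definition p_torsion_free :: "('t, 'b) ring_scheme \<Rightarrow> nat \<Rightarrow> bool"
  where "p_torsion_free T p \<longleftrightarrow>
    (\<forall>t\<in>carrier T. [p] \<cdot>\<^bsub>T\<^esub> t = \<zero>\<^bsub>T\<^esub> \<longrightarrow> t = \<zero>\<^bsub>T\<^esub>)"

definition nonzerodivisor :: "('t, 'b) ring_scheme \<Rightarrow> 't \<Rightarrow> bool"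
  where "nonzerodivisor T y \<longleftrightarrow>
    y \<in> carrier T \<and> (\<forall>t\<in>carrier T. y \<otimes>\<^bsub>T\<^esub> t = \<zero>\<^bsub>T\<^esub> \<longrightarrow> t = \<zero>\<^bsub>T\<^esub>)"

text \<open>Here and below, \<open>\<rho> n\<close> stands for $\pi^{1/p^n}$.\<close>

definition compatible_roots :: "('t, 'b) ring_scheme \<Rightarrow> nat \<Rightarrow> 't \<Rightarrow> (nat \<Rightarrow> 't) \<Rightarrow> bool"
  where "compatible_roots T p \<pi> \<rho> \<longleftrightarrow>
    \<rho> 0 = \<pi> \<and> (\<forall>n. \<rho> n \<in> carrier T) \<and>
    (\<forall>n m. m \<le> n \<longrightarrow> \<rho> n [^]\<^bsub>T\<^esub> (p ^ m) = \<rho> (n - m))"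

text \<open>For ideals \<open>I \<subseteq> J\<close> of \<open>T\<close>: the \<open>T\<close>-module \<open>J/I\<close>, seen inside \<open>T/I\<close>, is almost zero.\<close>

definition almost_zero_quotient ::
    "('t, 'b) ring_scheme \<Rightarrow> (nat \<Rightarrow> 't) \<Rightarrow> 't set \<Rightarrow> 't set \<Rightarrow> bool"
  where "almost_zero_quotient T \<rho> J I \<longleftrightarrow>
    (\<forall>n>0. \<forall>y\<in>J. (I +>\<^bsub>T\<^esub> \<rho> n) \<otimes>\<^bsub>T Quot I\<^esub> (I +>\<^bsub>T\<^esub> y) = \<zero>\<^bsub>T Quot I\<^esub>)"

definition extended_ideal :: "('a, 't, 'c) module_scheme \<Rightarrow> 'a set \<Rightarrow> 't set"
  where "extended_ideal T S = Idl\<^bsub>T\<^esub> ((\<lambda>r. r \<odot>\<^bsub>T\<^esub> \<one>\<^bsub>T\<^esub>) ` S)"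

definition ideal_colon_elt :: "('a, 't, 'c) module_scheme \<Rightarrow> 't set \<Rightarrow> 'a \<Rightarrow> 't set"
  where "ideal_colon_elt T I r = {t \<in> carrier T. r \<odot>\<^bsub>T\<^esub> t \<in> I}"

text \<open>Lists are indexed from \<open>0\<close>: \<open>take i xs\<close> is $x_1,\dots,x_i$ and \<open>xs ! i\<close> is $x_{i+1}$.\<close>

definition almost_big_CM ::
    "('a, 'b) ring_scheme \<Rightarrow> 'a set \<Rightarrow> ('a, 't, 'c) module_scheme \<Rightarrow> (nat \<Rightarrow> 't) \<Rightarrow> bool"
  where "almost_big_CM R \<mm> T \<rho> \<longleftrightarrow>
    \<not> almost_zero_quotient T \<rho> (carrier T) (extended_ideal T \<mm>) \<and>
    (\<forall>xs. system_of_parameters R \<mm> xs \<longrightarrow>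
      (\<forall>i<length xs. almost_zero_quotient T \<rho>
         (ideal_colon_elt T (extended_ideal T (set (take i xs))) (xs ! i))
         (extended_ideal T (set (take i xs)))))"


section \<open>Tensor products of modules\<close>

text \<open>The abelian group $A \otimes_R B$: the free abelian group on \<open>carrier A \<times> carrier B\<close> modulo
  the subgroup generated by the bilinearity and balancing relations. It is written
  multiplicatively, as is \<^const>\<open>free_Abelian_group\<close>.\<close>

definition tensor_relators :: "('a, 'b) ring_scheme \<Rightarrow> ('a, 'x, 'c) module_scheme \<Rightarrow>
    ('a, 'y, 'd) module_scheme \<Rightarrow> ('x \<times> 'y \<Rightarrow>\<^sub>0 int) set"
  where "tensor_relators R A B =
    {frag_of (x \<oplus>\<^bsub>A\<^esub> x', y) - frag_of (x, y) - frag_of (x', y) | x x' y.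
       x \<in> carrier A \<and> x' \<in> carrier A \<and> y \<in> carrier B} \<union>
    {frag_of (x, y \<oplus>\<^bsub>B\<^esub> y') - frag_of (x, y) - frag_of (x, y') | x y y'.
       x \<in> carrier A \<and> y \<in> carrier B \<and> y' \<in> carrier B} \<union>
    {frag_of (r \<odot>\<^bsub>A\<^esub> x, y) - frag_of (x, r \<odot>\<^bsub>B\<^esub> y) | r x y.
       r \<in> carrier R \<and> x \<in> carrier A \<and> y \<in> carrier B}"

definition tensor_kernel :: "('a, 'b) ring_scheme \<Rightarrow> ('a, 'x, 'c) module_scheme \<Rightarrow>
    ('a, 'y, 'd) module_scheme \<Rightarrow> ('x \<times> 'y \<Rightarrow>\<^sub>0 int) set"
  where "tensor_kernel R A B =
    generate (free_Abelian_group (carrier A \<times> carrier B)) (tensor_relators R A B)"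

definition tensor_product :: "('a, 'b) ring_scheme \<Rightarrow> ('a, 'x, 'c) module_scheme \<Rightarrow>
    ('a, 'y, 'd) module_scheme \<Rightarrow> ('x \<times> 'y \<Rightarrow>\<^sub>0 int) set monoid"
  where "tensor_product R A B =
    free_Abelian_group (carrier A \<times> carrier B) Mod tensor_kernel R A B"

definition tensor_class :: "('a, 'b) ring_scheme \<Rightarrow> ('a, 'x, 'c) module_scheme \<Rightarrow>
    ('a, 'y, 'd) module_scheme \<Rightarrow> ('x \<times> 'y \<Rightarrow>\<^sub>0 int) \<Rightarrow> ('x \<times> 'y \<Rightarrow>\<^sub>0 int) set"
  where "tensor_class R A B c =
    tensor_kernel R A B #>\<^bsub>free_Abelian_group (carrier A \<times> carrier B)\<^esub> c"

definition pure_tensor :: "('a, 'b) ring_scheme \<Rightarrow> ('a, 'x, 'c) module_scheme \<Rightarrow>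
    ('a, 'y, 'd) module_scheme \<Rightarrow> 'x \<Rightarrow> 'y \<Rightarrow> ('x \<times> 'y \<Rightarrow>\<^sub>0 int) set"
  where "pure_tensor R A B x y = tensor_class R A B (frag_of (x, y))"

text \<open>For linear maps \<open>f\<close> and \<open>g\<close> into \<open>A'\<close> and \<open>B'\<close>, the map $f \otimes g$ with values in
  $A' \otimes_R B'$. All members \<open>c\<close> of a coset \<open>Z\<close> contribute the same class to the union.\<close>

definition tensor_map :: "('a, 'b) ring_scheme \<Rightarrow> ('a, 'x, 'c) module_scheme \<Rightarrow>
    ('a, 'y, 'd) module_scheme \<Rightarrow> ('v \<Rightarrow> 'x) \<Rightarrow> ('w \<Rightarrow> 'y) \<Rightarrow>
    ('v \<times> 'w \<Rightarrow>\<^sub>0 int) set \<Rightarrow> ('x \<times> 'y \<Rightarrow>\<^sub>0 int) set"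
  where "tensor_map R A' B' f g Z =
    (\<Union>c\<in>Z. tensor_class R A' B' (frag_extend (\<lambda>(v, w). frag_of (f v, g w)) c))"


section \<open>Closure operation, test ideal and trace ideal\<close>

text \<open>The submodule \<open>N\<close> of \<open>M\<close> is the module \<open>M\<lparr>carrier := N\<rparr>\<close>, and its inclusion is \<^const>\<open>id\<close>.\<close>

definition almost_closure :: "('a, 'b) ring_scheme \<Rightarrow> ('a, 't, 'c) module_scheme \<Rightarrow>
    (nat \<Rightarrow> 't) \<Rightarrow> ('a, 'm) module \<Rightarrow> 'm set \<Rightarrow> 'm set"
  where "almost_closure R T \<rho> M N =
    {u \<in> carrier M. \<forall>n>0. pure_tensor R T M (\<rho> n) u
       \<in> tensor_map R T M id id ` carrier (tensor_product R T (M\<lparr>carrier := N\<rparr>))}"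

definition module_colon ::
    "('a, 'b) ring_scheme \<Rightarrow> ('a, 'm, 'c) module_scheme \<Rightarrow> 'm set \<Rightarrow> 'm set \<Rightarrow> 'a set"
  where "module_colon R M N L = {r \<in> carrier R. \<forall>u\<in>L. r \<odot>\<^bsub>M\<^esub> u \<in> N}"

text \<open>The intersection over all pairs of modules \<open>N \<subseteq> M\<close> whose underlying sets live in the type
  \<open>'m\<close>. HOL has no quantification over types, so \<open>'m\<close> is a parameter (determined by the type of
  the closure operation); it plays the role of a universe.\<close>

definition test_ideal ::
    "('a, 'b) ring_scheme \<Rightarrow> (('a, 'm) module \<Rightarrow> 'm set \<Rightarrow> 'm set) \<Rightarrow> 'a set"
  where "test_ideal R cl =
    \<Inter>{module_colon R M N (cl M N) | M N. module R M \<and> submodule N R M}"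

definition self_module :: "('a, 'b) ring_scheme \<Rightarrow> ('a, 'a) module"
  where "self_module R = \<lparr>carrier = carrier R, monoid.mult = monoid.mult R, one = one R,
    ring.zero = ring.zero R, ring.add = ring.add R, smult = monoid.mult R\<rparr>"

definition mod_homs :: "('a, 'b) ring_scheme \<Rightarrow> ('a, 'x, 'c) module_scheme \<Rightarrow>
    ('a, 'y, 'd) module_scheme \<Rightarrow> ('x \<Rightarrow> 'y) set"
  where "mod_homs R A B = {f \<in> carrier A \<rightarrow> carrier B.
    (\<forall>x\<in>carrier A. \<forall>x'\<in>carrier A. f (x \<oplus>\<^bsub>A\<^esub> x') = f x \<oplus>\<^bsub>B\<^esub> f x') \<and>
    (\<forall>r\<in>carrier R. \<forall>x\<in>carrier A. f (r \<odot>\<^bsub>A\<^esub> x) = r \<odot>\<^bsub>B\<^esub> f x)}"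

text \<open>The sum of a family of ideals is the ideal generated by their union.\<close>

definition almost_trace :: "('a, 'b) ring_scheme \<Rightarrow> ('a, 't, 'c) module_scheme \<Rightarrow>
    (nat \<Rightarrow> 't) \<Rightarrow> 'a set"
  where "almost_trace R T \<rho> = Idl\<^bsub>R\<^esub>
    (\<Union>n\<in>{0<..}. \<Union>\<psi>\<in>mod_homs R T (self_module R). \<psi> ` ((\<lambda>t. \<rho> n \<otimes>\<^bsub>T\<^esub> t) ` carrier T))"

end

theory Submission
  imports Defs
begin

text \<open>
  Let \<open>I\<close> be the trace ideal and write \<open>\<rho> n\<close> for the \<open>p\<^sup>n\<close>-th root of \<open>\<pi>\<close>.

  The trace ideal is contained in the test ideal since a homomorphism \<open>\<psi> : T \<rightarrow> R\<close> and an element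
  \<open>t\<close> of \<open>T\<close> induce a map \<open>x \<otimes> m \<mapsto> \<psi>(x t) m\<close> from \<open>T \<otimes> M\<close> to \<open>M\<close>. It sends the image of \<open>T \<otimes> N\<close> into \<open>N\<close>
  and \<open>\<rho> n \<otimes> u\<close> to \<open>\<psi>(\<rho> n t) u\<close> (\<open>functional_contracts_image\<close>).

  For the converse one usually dualizes into the injective hull of the residue field. Here its role
  is taken by the algebraic compactness of the complete local ring \<open>R\<close>: a system of linear
  congruences over \<open>R\<close> is solvable as soon as its finite subsystems are (\<open>algebraically_compact\<close>).
  Homomorphisms from \<open>T\<close> to \<open>R\<close> are the solutions of the system of all linear relations of \<open>T\<close>.

  Let \<open>r\<close> be outside \<open>I\<close>. By Krull's theorem \<open>r\<close> is outside \<open>Q = I + \<mm>\<^sup>k\<close> for some \<open>k\<close>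
  (\<open>krull_closed\<close>). No homomorphism maps a root \<open>\<rho> n\<close> outside \<open>Q\<close>, and by compactness finitely many
  linear relations of \<open>T\<close> are responsible for this (\<open>finite_obstruction\<close>). Given relations
  \<open>\<Sum>\<^sub>t \<alpha>\<^sub>i\<^sub>t t = 0\<close> of this kind, take the free module with a basis vector \<open>e\<^sub>i\<close> for each of them, and
  another one, \<open>e\<^sub>0\<close>. Let \<open>N\<close> be spanned by the columns \<open>c\<^sub>t = \<Sum>\<^sub>i \<alpha>\<^sub>i\<^sub>t e\<^sub>i\<close>, with \<open>e\<^sub>0\<close> added to
  the column of \<open>\<rho> n\<close>. Then \<open>\<rho> n \<otimes> e\<^sub>0 = \<Sum>\<^sub>t t \<otimes> c\<^sub>t\<close> comes from \<open>T \<otimes> N\<close>, whereas \<open>r e\<^sub>0\<close> is in \<open>N\<close>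
  only if some solution of the finite system has the value \<open>r\<close> at \<open>\<rho> n\<close>, which forces \<open>r\<close> into \<open>Q\<close>.
  Doing this for all \<open>n\<close> in one free module, with one common vector \<open>e\<^sub>0\<close>, turns \<open>e\<^sub>0\<close> into an element
  of the closure of \<open>N\<close> with \<open>r e\<^sub>0\<close> outside \<open>N\<close> (\<open>separating_module\<close>). So \<open>r\<close> is not in the test ideal.
  This module has a countable basis, hence not more elements than the infinite ring \<open>R\<close>, and fits
  into every type into which \<open>R\<close> can be injected.
\<close>

section \<open>Ideals of noetherian local rings\<close>

no_notation Sum_Type.Plus (infixr \<open><+>\<close> 65)

lemma (in ring) add_ideal_iff: "x \<in> I <+> J \<longleftrightarrow> (\<exists>i\<in>I. \<exists>j\<in>J. x = i \<oplus> j)"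
  by (auto simp: set_add_def')

lemma (in ring) add_ideal_upper:
  assumes "ideal I R" "ideal J R"
  shows "I \<subseteq> I <+> J" "J \<subseteq> I <+> J"
proof -
  interpret I: ideal I R by fact
  interpret J: ideal J R by fact
  show "I \<subseteq> I <+> J"
    unfolding add_ideal_iff subset_iff by (metis I.Icarr J.zero_closed r_zero)
  show "J \<subseteq> I <+> J"
    unfolding add_ideal_iff subset_iff by (metis I.zero_closed J.Icarr l_zero)
qed

lemma (in ring) add_ideal_least:
  assumes "I \<subseteq> K" "J \<subseteq> K" "ideal K R"
  shows "I <+> J \<subseteq> K"
proof -
  interpret K: ideal K R by fact
  show ?thesis using assms(1,2) K.a_closed unfolding add_ideal_iff subset_iff by metis
qed

lemma (in ring) add_ideal_mono: "I \<subseteq> I' \<Longrightarrow> J \<subseteq> J' \<Longrightarrow> I <+> J \<subseteq> I' <+> J'"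
  unfolding set_add_def' by blast

lemma (in ring) ideal_diff_closed:
  assumes "ideal I R" "x \<in> I" "y \<in> I"
  shows "x \<ominus> y \<in> I"
  using assms by (simp add: a_minus_def additive_subgroup.a_closed additive_subgroup.a_inv_closed ideal.axioms(1))

lemma (in ring) ideal_prod_subset:
  assumes "ideal K R" "\<And>i j. i \<in> I \<Longrightarrow> j \<in> J \<Longrightarrow> i \<otimes> j \<in> K"
  shows "I \<cdot> J \<subseteq> K"
proof
  interpret K: ideal K R by fact
  fix x assume "x \<in> I \<cdot> J"
  then show "x \<in> K"
  proof induction
    case (prod i j)
    then show ?case by (rule assms(2))
  next
    case (sum s1 s2)
    then show ?case by simp
  qed
qed

lemma (in cring) principal_iff: "x \<in> PIdl a \<longleftrightarrow> (\<exists>r\<in>carrier R. x = r \<otimes> a)"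
  by (auto simp: cgenideal_def)

lemma (in cring) add_principal_iff:
  "x \<in> J <+> PIdl a \<longleftrightarrow> (\<exists>j\<in>J. \<exists>r\<in>carrier R. x = j \<oplus> r \<otimes> a)"
  by (fastforce simp: add_ideal_iff principal_iff)

lemma (in noetherian_ring) maximal_ideal_in_family:
  assumes "\<F> \<noteq> {}" "\<And>J. J \<in> \<F> \<Longrightarrow> ideal J R"
  shows "\<exists>J\<in>\<F>. \<forall>K\<in>\<F>. J \<subseteq> K \<longrightarrow> K = J"
proof (rule subset_Zorn_nonempty[OF assms(1)])
  fix C assume C: "C \<noteq> {}" "subset.chain \<F> C"
  then have "subset.chain {I. ideal I R} C"
    using assms(2) by (auto simp: pred_on.chain_def)
  from ideal_chain_is_trivial[OF C(1) this] show "\<Union>C \<in> \<F>"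
    using C(2) by (auto simp: pred_on.chain_def)
qed

lemma (in noetherian_ring) noetherian_induct [consumes 1, case_names ideal]:
  assumes "ideal J R"
    and step: "\<And>J. ideal J R \<Longrightarrow> (\<And>K. ideal K R \<Longrightarrow> J \<subset> K \<Longrightarrow> P K) \<Longrightarrow> P J"
  shows "P J"
proof (rule ccontr)
  assume "\<not> P J"
  then have "{J. ideal J R \<and> \<not> P J} \<noteq> {}"
    using assms(1) by blast
  from maximal_ideal_in_family[OF this] obtain K where "ideal K R" "\<not> P K"
    "\<And>L. ideal L R \<Longrightarrow> \<not> P L \<Longrightarrow> K \<subseteq> L \<Longrightarrow> L = K"
    by blast
  with step[of K] show False by blast
qed

locale noetherian_local_ring =
  noetherian_ring R + cring R + max: maximalideal \<mm> R for R (structure) and \<mm> +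
  assumes unique_maximal: "maximalideal J R \<Longrightarrow> J = \<mm>"
begin

lemma unit_if_notin_max:
  assumes "u \<in> carrier R" "u \<notin> \<mm>"
  shows "u \<in> Units R"
proof (rule ccontr)
  assume nonunit: "u \<notin> Units R"
  define \<F> where "\<F> = {J. ideal J R \<and> PIdl u \<subseteq> J \<and> \<one> \<notin> J}"
  have "\<one> \<notin> PIdl u"
  proof
    assume "\<one> \<in> PIdl u"
    then obtain r where r: "r \<in> carrier R" "\<one> = r \<otimes> u" unfolding principal_iff by blast
    moreover have "u \<otimes> r = \<one>" using r assms(1) m_comm by simp
    ultimately have "u \<in> Units R" unfolding Units_def using assms(1) by auto
    then show False using nonunit by simp
  qed
  then have "PIdl u \<in> \<F>"
    unfolding \<F>_def using cgenideal_ideal assms(1) by blast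
  then have "\<F> \<noteq> {}" "\<And>J. J \<in> \<F> \<Longrightarrow> ideal J R"
    unfolding \<F>_def by auto
  from maximal_ideal_in_family[OF this] obtain J
    where J: "J \<in> \<F>" "\<And>K. K \<in> \<F> \<Longrightarrow> J \<subseteq> K \<Longrightarrow> K = J"
    by blast
  have "maximalideal J R"
  proof (rule maximalidealI)
    show "ideal J R" "carrier R \<noteq> J"
      using J(1) unfolding \<F>_def by auto
    fix K assume K: "ideal K R" "J \<subseteq> K" "K \<subseteq> carrier R"
    show "K = J \<or> K = carrier R"
    proof (cases "\<one> \<in> K")
      case True
      with K(1) show ?thesis using ideal.one_imp_carrier by blast
    next
      case False
      then have "K \<in> \<F>" using K J(1) unfolding \<F>_def by blast
      with J(2) K(2) show ?thesis by blast
    qed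
  qed
  then have "J = \<mm>" by (rule unique_maximal)
  moreover have "u \<in> J"
    using J(1) cgenideal_self[OF assms(1)] unfolding \<F>_def by blast
  ultimately show False using assms(2) by blast
qed

definition adic_power :: "nat \<Rightarrow> 'a set"
  where "adic_power k = \<mm> [^]\<^bsub>ideals_set R\<^esub> k"

lemma adic_power_0: "adic_power 0 = carrier R"
proof -
  interpret S: comm_monoid "ideals_set R" by (rule ideals_set_is_comm_monoid)
  show ?thesis by (simp add: adic_power_def ideals_set_def)
qed

lemma adic_power_Suc: "adic_power (Suc k) = adic_power k \<cdot> \<mm>"
proof -
  interpret S: comm_monoid "ideals_set R" by (rule ideals_set_is_comm_monoid)
  show ?thesis by (simp add: adic_power_def ideals_set_def)
qed

lemma adic_power_ideal: "ideal (adic_power k) R"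
  by (induction k) (simp_all add: adic_power_0 adic_power_Suc oneideal ideal_prod_is_ideal max.is_ideal)

lemma adic_power_add: "adic_power (j + k) = adic_power j \<cdot> adic_power k"
proof -
  interpret S: comm_monoid "ideals_set R" by (rule ideals_set_is_comm_monoid)
  have "\<mm> \<in> carrier (ideals_set R)" by (simp add: ideals_set_def max.is_ideal)
  from S.nat_pow_mult[OF this, of j k] show ?thesis by (simp add: adic_power_def ideals_set_def)
qed

text \<open>An ideal \<open>J\<close> containing some power of each element of \<open>\<mm>\<close> contains a power of \<open>\<mm>\<close>. By
  noetherian induction: if \<open>x \<in> \<mm>\<close> is outside \<open>J\<close> with \<open>x\<^sup>2 \<in> J\<close>, then a power of \<open>\<mm>\<close> lies in
  \<open>J + (x)\<close>, and the square of that ideal lies in \<open>J\<close>.\<close>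

lemma adic_power_subset_if_radical:
  assumes "ideal J R" "\<And>y. y \<in> \<mm> \<Longrightarrow> \<exists>s::nat. y [^] s \<in> J"
  shows "\<exists>k. adic_power k \<subseteq> J"
  using assms
proof (induction J rule: noetherian_induct)
  case (ideal J)
  interpret J: ideal J R by (rule ideal(1))
  show ?case
  proof (cases "\<mm> \<subseteq> J")
    case True
    have "adic_power 1 \<subseteq> \<mm>"
      using ideal_prod_inter[OF adic_power_ideal[of 0] max.is_ideal] adic_power_Suc[of 0] by simp
    with True show ?thesis by blast
  next
    case False
    then obtain y where y: "y \<in> \<mm>" "y \<notin> J" by blast
    then have yR: "y \<in> carrier R" using max.Icarr by blast
    define s where "s = (LEAST s::nat. y [^] s \<in> J)"
    have s: "y [^] s \<in> J"
      unfolding s_def using ideal(3)[OF y(1)] LeastI_ex[of "\<lambda>s::nat. y [^] s \<in> J"] by blast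
    have least: "y [^] i \<notin> J" if "i < s" for i :: nat
      using that not_less_Least[of i "\<lambda>s. y [^] s \<in> J"] unfolding s_def by blast
    have "s \<noteq> 1" using s y(2) yR by auto
    moreover have "s \<noteq> 0"
    proof
      assume "s = 0"
      then have "\<one> \<in> J" using s by simp
      then show False using y(2) yR J.one_imp_carrier by blast
    qed
    ultimately have s2: "s \<ge> 2" by linarith
    define x where "x = y [^] (s - 1)"
    have xR: "x \<in> carrier R" unfolding x_def using yR by simp
    have xJ: "x \<notin> J" unfolding x_def using least[of "s - 1"] s2 by simp
    have "x \<otimes> x = y [^] s \<otimes> y [^] (s - 2)"
      unfolding x_def using s2 yR by (simp add: nat_pow_mult numeral_2_eq_2)
    then have xx: "x \<otimes> x \<in> J" using s yR J.I_r_closed by simp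
    let ?K = "J <+> PIdl x"
    have K: "ideal ?K R" using add_ideals ideal(1) cgenideal_ideal[OF xR] by blast
    have JK: "J \<subseteq> ?K" "x \<in> ?K"
      using add_ideal_upper[OF ideal(1) cgenideal_ideal[OF xR]] cgenideal_self[OF xR] by auto
    then obtain k where k: "adic_power k \<subseteq> ?K"
      using ideal(2)[of ?K] K xJ ideal(3) by blast
    have "adic_power k \<cdot> adic_power k \<subseteq> J"
    proof (rule ideal_prod_subset[OF ideal(1)])
      fix a b assume "a \<in> adic_power k" "b \<in> adic_power k"
      then have "a \<in> ?K" "b \<in> ?K" using k by auto
      then obtain i c i' c' where ab: "i \<in> J" "c \<in> carrier R" "a = i \<oplus> c \<otimes> x"
          "i' \<in> J" "c' \<in> carrier R" "b = i' \<oplus> c' \<otimes> x"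
        unfolding add_principal_iff by blast
      then have R: "i \<in> carrier R" "i' \<in> carrier R" using J.Icarr by auto
      have "a \<otimes> b = i \<otimes> b \<oplus> (i' \<otimes> (c \<otimes> x) \<oplus> (c \<otimes> c') \<otimes> (x \<otimes> x))"
        unfolding ab(3,6) using ab(2,5) R xR by algebra
      moreover have "i \<otimes> b \<in> J" "i' \<otimes> (c \<otimes> x) \<in> J" "(c \<otimes> c') \<otimes> (x \<otimes> x) \<in> J"
        using ab R xR xx J.I_r_closed J.I_l_closed by auto
      ultimately show "a \<otimes> b \<in> J" by simp
    qed
    then show ?thesis using adic_power_add[of k k] by auto
  qed
qed

text \<open>Every ideal \<open>I\<close> is closed in the \<open>\<mm>\<close>-adic topology. To separate \<open>r\<close> from \<open>I\<close>, choose \<open>J \<supseteq> I\<close>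
  maximal among the ideals without \<open>r\<close>: every larger ideal contains \<open>r\<close>, which forces
  \<open>\<mm> r \<subseteq> J\<close> (as \<open>1 - b y\<close> is a unit for \<open>y \<in> \<mm>\<close>) and then \<open>y\<^sup>s \<in> J\<close> as soon as the chain of ideals
  \<open>(J : y\<^sup>s)\<close> is stationary.\<close>

proposition krull_closed:
  assumes "ideal I R" "r \<in> carrier R" "r \<notin> I"
  shows "\<exists>k. r \<notin> I <+> adic_power k"
proof -
  define \<F> where "\<F> = {J. ideal J R \<and> I \<subseteq> J \<and> r \<notin> J}"
  have "\<F> \<noteq> {}" "\<And>J. J \<in> \<F> \<Longrightarrow> ideal J R"
    using assms unfolding \<F>_def by auto
  from maximal_ideal_in_family[OF this] obtain J
    where "J \<in> \<F>" and maximal: "\<And>K. K \<in> \<F> \<Longrightarrow> J \<subseteq> K \<Longrightarrow> K = J"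
    by blast
  then have J: "ideal J R" "I \<subseteq> J" "r \<notin> J" unfolding \<F>_def by auto
  interpret J: ideal J R by (rule J(1))
  have in_larger: "\<exists>j\<in>J. \<exists>b\<in>carrier R. r = j \<oplus> b \<otimes> x" if x: "x \<in> carrier R" "x \<notin> J" for x
  proof -
    have "ideal (J <+> PIdl x) R" "J \<subseteq> J <+> PIdl x" "x \<in> J <+> PIdl x"
      using add_ideals[OF J(1)] add_ideal_upper[OF J(1)] cgenideal_ideal cgenideal_self x by blast+
    then have "J <+> PIdl x \<notin> \<F>"
      using maximal[of "J <+> PIdl x"] x(2) by auto
    then have "r \<in> J <+> PIdl x"
      using \<open>ideal (J <+> PIdl x) R\<close> \<open>J \<subseteq> J <+> PIdl x\<close> J(2) unfolding \<F>_def by auto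
    then show ?thesis unfolding add_principal_iff .
  qed
  have mr: "y \<otimes> r \<in> J" if y: "y \<in> \<mm>" for y
  proof (rule ccontr)
    assume notin: "y \<otimes> r \<notin> J"
    have yR: "y \<in> carrier R" using y max.Icarr by blast
    obtain j b where jb: "j \<in> J" "b \<in> carrier R" "r = j \<oplus> b \<otimes> (y \<otimes> r)"
      using in_larger[OF _ notin] yR assms(2) by blast
    have "\<one> \<ominus> b \<otimes> y \<notin> \<mm>"
    proof
      assume "\<one> \<ominus> b \<otimes> y \<in> \<mm>"
      then have "(\<one> \<ominus> b \<otimes> y) \<oplus> b \<otimes> y \<in> \<mm>"
        using max.a_closed max.I_l_closed[OF y jb(2)] by blast
      moreover have "(\<one> \<ominus> b \<otimes> y) \<oplus> b \<otimes> y = \<one>"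
        using jb(2) yR by algebra
      ultimately show False
        using max.one_imp_carrier max.I_notcarr by auto
    qed
    then have unit: "\<one> \<ominus> b \<otimes> y \<in> Units R"
      using unit_if_notin_max jb(2) yR by simp
    have jR: "j \<in> carrier R" using jb(1) J.Icarr by blast
    have "(\<one> \<ominus> b \<otimes> y) \<otimes> r = r \<ominus> b \<otimes> (y \<otimes> r)"
      using jb(2) yR assms(2) by algebra
    also have "\<dots> = (j \<oplus> b \<otimes> (y \<otimes> r)) \<ominus> b \<otimes> (y \<otimes> r)" using jb(3) by simp
    also have "\<dots> = j" using jR jb(2) yR assms(2) by algebra
    finally have "inv (\<one> \<ominus> b \<otimes> y) \<otimes> ((\<one> \<ominus> b \<otimes> y) \<otimes> r) \<in> J"
      using jb(1) J.I_l_closed Units_inv_closed[OF unit] by simp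
    moreover have "inv (\<one> \<ominus> b \<otimes> y) \<otimes> ((\<one> \<ominus> b \<otimes> y) \<otimes> r) = r"
      using unit assms(2) by (metis Units_closed Units_inv_closed Units_l_inv l_one m_assoc)
    ultimately show False using J(3) by simp
  qed
  have "\<exists>s::nat. y [^] s \<in> J" if y: "y \<in> \<mm>" for y
  proof (rule ccontr)
    assume none: "\<nexists>s::nat. y [^] s \<in> J"
    have yR: "y \<in> carrier R" using y max.Icarr by blast
    define C where "C s = {b \<in> carrier R. b \<otimes> y [^] (s::nat) \<in> J}" for s
    have C_ideal: "ideal (C s) R" for s
    proof -
      have "C s = {b \<in> carrier R. y [^] s \<otimes> b \<in> J}"
        unfolding C_def using m_comm yR by fastforce
      then show ?thesis
        using J.helper_max_prime[OF cring_axioms, of "y [^] s"] yR by simp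
    qed
    have C_step: "C s \<subseteq> C (Suc s)" for s
      unfolding C_def using yR J.I_r_closed by (auto simp: m_assoc[symmetric])
    have "range C \<noteq> {}" "\<And>J. J \<in> range C \<Longrightarrow> ideal J R"
      using C_ideal by auto
    from maximal_ideal_in_family[OF this] obtain s where "\<forall>K\<in>range C. C s \<subseteq> K \<longrightarrow> K = C s"
      by blast
    then have stable: "C (Suc s) = C s" using C_step by blast
    obtain j b where jb: "j \<in> J" "b \<in> carrier R" "r = j \<oplus> b \<otimes> y [^] s"
      using in_larger[of "y [^] s"] yR none by blast
    have jR: "j \<in> carrier R" using jb(1) J.Icarr by blast
    have "b \<otimes> y [^] Suc s = y \<otimes> r \<ominus> y \<otimes> j"
      unfolding jb(3) nat_pow_Suc using jb(2) yR jR nat_pow_closed[OF yR, of s] by algebra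
    then have "b \<in> C (Suc s)"
      using mr[OF y] ideal_diff_closed[OF J(1)] J.I_l_closed[OF jb(1) yR] jb(2)
      unfolding C_def by auto
    then have "b \<otimes> y [^] s \<in> J" using stable unfolding C_def by blast
    then show False using jb J(3) J.a_closed by blast
  qed
  then obtain k where "adic_power k \<subseteq> J"
    using adic_power_subset_if_radical[OF J(1)] by blast
  then have "I <+> adic_power k \<subseteq> J"
    using add_ideal_least J by blast
  then have "r \<notin> I <+> adic_power k" using J(3) by auto
  then show ?thesis by (rule exI)
qed

text \<open>In the last power of \<open>\<mm>\<close> not contained in \<open>J\<close>, any element outside \<open>J\<close> will do.\<close>

lemma socle_element:
  assumes J: "ideal J R" "J \<noteq> carrier R" "adic_power k \<subseteq> J"
  obtains x where "x \<in> carrier R" "x \<notin> J" "\<And>y. y \<in> \<mm> \<Longrightarrow> y \<otimes> x \<in> J"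
proof -
  define i where "i = (LEAST i. adic_power i \<subseteq> J)"
  have i: "adic_power i \<subseteq> J"
    unfolding i_def using LeastI[of "\<lambda>i. adic_power i \<subseteq> J", OF J(3)] .
  have "i \<noteq> 0"
  proof
    assume "i = 0"
    then have "carrier R \<subseteq> J" using i by (simp add: adic_power_0)
    moreover have "J \<subseteq> carrier R" using ideal.Icarr[OF J(1)] by auto
    ultimately show False using J(2) by auto
  qed
  then obtain l where l: "i = Suc l" using not0_implies_Suc by blast
  then have "\<not> adic_power l \<subseteq> J"
    using not_less_Least[of l "\<lambda>i. adic_power i \<subseteq> J"] unfolding i_def by auto
  then obtain x where x: "x \<in> adic_power l" "x \<notin> J" by blast
  have xR: "x \<in> carrier R" using x(1) ideal.Icarr[OF adic_power_ideal] by blast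
  have "y \<otimes> x \<in> J" if "y \<in> \<mm>" for y
  proof -
    have "x \<otimes> y \<in> adic_power i"
      unfolding l adic_power_Suc using x(1) that by (rule ideal_prod.prod)
    moreover have "x \<otimes> y = y \<otimes> x" using xR max.Icarr[OF that] m_comm by simp
    ultimately show ?thesis using i by auto
  qed
  then show thesis using that xR x(2) by blast
qed

text \<open>The quotients \<open>R/\<mm>\<^sup>k\<close> are artinian. Noetherian induction on the ideal \<open>J\<close> below the family: for
  \<open>x\<close> outside \<open>J\<close> with \<open>\<mm> x \<subseteq> J\<close>, an ideal \<open>A \<supseteq> J\<close> is determined, within a chain, by \<open>A + (x)\<close> and by
  whether it contains \<open>x\<close>.\<close>

proposition minimal_ideal_in_family:
  assumes "ideal J R" "adic_power k \<subseteq> J" "\<F> \<noteq> {}" "\<And>A. A \<in> \<F> \<Longrightarrow> ideal A R \<and> J \<subseteq> A"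
  shows "\<exists>A\<in>\<F>. \<forall>B\<in>\<F>. B \<subseteq> A \<longrightarrow> B = A"
  using assms
proof (induction J arbitrary: \<F> rule: noetherian_induct)
  case (ideal J)
  show ?case
  proof (cases "J = carrier R")
    case True
    have all: "A = carrier R" if "A \<in> \<F>" for A
    proof
      show "A \<subseteq> carrier R" using ideal(5)[OF that] ideal.Icarr[of A R] by auto
      show "carrier R \<subseteq> A" using ideal(5)[OF that] True by simp
    qed
    obtain A where "A \<in> \<F>" using ideal(4) by auto
    then show ?thesis using all by metis
  next
    case False
    then obtain x where x: "x \<in> carrier R" "x \<notin> J" and socle: "\<And>y. y \<in> \<mm> \<Longrightarrow> y \<otimes> x \<in> J"
      using socle_element[OF ideal(1) _ ideal(3)] by blast
    let ?K = "J <+> PIdl x"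
    have K: "ideal ?K R" using add_ideals ideal(1) cgenideal_ideal[OF x(1)] by blast
    have JK: "J \<subseteq> ?K" "x \<in> ?K"
      using add_ideal_upper[OF ideal(1) cgenideal_ideal[OF x(1)]] cgenideal_self[OF x(1)] by auto
    have "\<exists>A\<in>(\<lambda>A. A <+> ?K) ` \<F>. \<forall>B\<in>(\<lambda>A. A <+> ?K) ` \<F>. B \<subseteq> A \<longrightarrow> B = A"
    proof (rule ideal(2)[OF K, of "(\<lambda>A. A <+> ?K) ` \<F>"])
      show "J \<subset> ?K" using JK x(2) by (metis psubsetI)
      show "adic_power k \<subseteq> ?K" using ideal(3) JK(1) by (rule subset_trans)
      show "(\<lambda>A. A <+> ?K) ` \<F> \<noteq> {}" using ideal(4) by simp
      fix A assume "A \<in> (\<lambda>A. A <+> ?K) ` \<F>"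
      then obtain B where "A = B <+> ?K" "ideal B R" using ideal(5) by auto
      then show "ideal A R \<and> ?K \<subseteq> A"
        using add_ideals[OF _ K] add_ideal_upper(2)[OF _ K] by simp
    qed
    then obtain A0 where A0: "A0 \<in> \<F>" "\<And>B. B \<in> \<F> \<Longrightarrow> B <+> ?K \<subseteq> A0 <+> ?K \<Longrightarrow> B <+> ?K = A0 <+> ?K"
      by (auto simp only: bex_simps ball_simps)
    obtain A where A: "A \<in> \<F>" "A <+> ?K = A0 <+> ?K"
      and Ax: "x \<notin> A \<or> (\<forall>B\<in>\<F>. B <+> ?K = A0 <+> ?K \<longrightarrow> x \<in> B)"
      using A0(1) by metis
    have "B = A" if B: "B \<in> \<F>" "B \<subseteq> A" for B
    proof
      interpret A: ideal A R using A(1) ideal(5) by blast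
      interpret B: ideal B R using B(1) ideal(5) by blast
      have JB: "J \<subseteq> B" using B(1) ideal(5) by blast
      have eq: "B <+> ?K = A0 <+> ?K"
        using A0(2)[OF B(1)] add_ideal_mono[OF B(2) subset_refl, of ?K] A(2) by simp
      show "A \<subseteq> B"
      proof
        fix a assume a: "a \<in> A"
        then have "a \<in> B <+> ?K"
          using add_ideal_upper(1)[OF A.is_ideal K] A(2) eq by blast
        then obtain b c where "b \<in> B" "c \<in> ?K" "a = b \<oplus> c"
          using add_ideal_iff[of a B ?K] by auto
        then obtain j r where bjr: "b \<in> B" "j \<in> J" "r \<in> carrier R" "a = b \<oplus> (j \<oplus> r \<otimes> x)"
          using add_principal_iff[of c J x] by auto
        then have R: "b \<in> carrier R" "j \<in> carrier R" using B.Icarr JB by auto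
        have rxA: "r \<otimes> x \<in> A"
        proof -
          have "r \<otimes> x = a \<ominus> (b \<oplus> j)"
            unfolding bjr(4) using R bjr(3) x(1) by algebra
          then show ?thesis
            using ideal_diff_closed[OF A.is_ideal a] A.a_closed bjr(1,2) B(2) JB by auto
        qed
        have "r \<otimes> x \<in> B"
        proof (cases "x \<in> A")
          case True
          then show ?thesis using Ax B(1) eq bjr(3) B.I_l_closed by blast
        next
          case False
          have "r \<in> \<mm>"
          proof (rule ccontr)
            assume "r \<notin> \<mm>"
            then have r: "r \<in> Units R" using unit_if_notin_max bjr(3) by blast
            then have "inv r \<otimes> (r \<otimes> x) \<in> A" using rxA A.I_l_closed by blast
            moreover have "inv r \<otimes> (r \<otimes> x) = x"
              using r x(1) by (metis Units_closed Units_inv_closed Units_l_inv l_one m_assoc)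
            ultimately show False using False by simp
          qed
          then show ?thesis using socle JB by blast
        qed
        then show "a \<in> B" unfolding bjr(4) using bjr(1,2) JB B.a_closed by blast
      qed
    qed (rule B(2))
    then show ?thesis using A(1) by blast
  qed
qed

corollary minimal_ideal_in_indexed_family:
  assumes "ideal J R" "adic_power k \<subseteq> J" "D \<noteq> {}" "\<And>i. i \<in> D \<Longrightarrow> ideal (A i) R \<and> J \<subseteq> A i"
  shows "\<exists>i\<in>D. \<forall>j\<in>D. A j \<subseteq> A i \<longrightarrow> A j = A i"
proof -
  have "\<exists>B\<in>A ` D. \<forall>C\<in>A ` D. C \<subseteq> B \<longrightarrow> C = B"
  proof (rule minimal_ideal_in_family[OF assms(1,2)])
    show "A ` D \<noteq> {}" using assms(3) by simp
    show "ideal B R \<and> J \<subseteq> B" if "B \<in> A ` D" for B using that assms(4) by (elim imageE) simp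
  qed
  then show ?thesis by (simp only: bex_simps ball_simps)
qed

end

section \<open>Compactness of complete local rings\<close>

locale complete_local_ring = noetherian_local_ring +
  assumes complete: "adically_complete R \<mm>"
begin

lemma adic_limit:
  assumes "\<And>k. s k \<in> carrier R" "\<And>k. s (Suc k) \<ominus> s k \<in> adic_power k"
  shows "\<exists>a\<in>carrier R. \<forall>k. a \<ominus> s k \<in> adic_power k"
  using complete assms unfolding adically_complete_def adic_power_def by meson

text \<open>A downward directed family of cosets \<open>v\<^sub>i + J\<^sub>i\<close> has a common point. Modulo \<open>\<mm>\<^sup>k\<close> the cosets
  have a smallest one, because \<open>R/\<mm>\<^sup>k\<close> is artinian; it is the image of all sufficiently small members
  of the family. Hence a common point modulo \<open>\<mm>\<^sup>k\<close> lifts to a common point modulo \<open>\<mm>\<^sup>k\<^sup>+\<^sup>1\<close>. The limit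
  of such points lies in each \<open>v\<^sub>i + J\<^sub>i\<close>, as \<open>J\<^sub>i\<close> is closed.\<close>

proposition linearly_compact:
  fixes J :: "'i \<Rightarrow> 'a set" and v :: "'i \<Rightarrow> 'a"
  assumes "D \<noteq> {}"
    and J: "\<And>i. i \<in> D \<Longrightarrow> ideal (J i) R"
    and v: "\<And>i. i \<in> D \<Longrightarrow> v i \<in> carrier R"
    and directed: "\<And>i j. i \<in> D \<Longrightarrow> j \<in> D \<Longrightarrow>
      \<exists>l\<in>D. J l \<subseteq> J i \<and> J l \<subseteq> J j \<and> v l \<ominus> v i \<in> J i \<and> v l \<ominus> v j \<in> J j"
  shows "\<exists>a\<in>carrier R. \<forall>i\<in>D. a \<ominus> v i \<in> J i"
proof -
  have sum_ideal: "ideal (J i <+> adic_power k) R" if "i \<in> D" for i k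
    using add_ideals[OF J[OF that] adic_power_ideal] .
  have "\<exists>m\<in>D. \<forall>i\<in>D. J i <+> adic_power k \<subseteq> J m <+> adic_power k \<longrightarrow>
      J i <+> adic_power k = J m <+> adic_power k" for k
    using sum_ideal add_ideal_upper(2)[OF J adic_power_ideal]
    by (intro minimal_ideal_in_indexed_family[OF adic_power_ideal[of k] subset_refl assms(1)]) simp
  then obtain m where m: "\<And>k. m k \<in> D"
    and minimal: "\<And>k i. i \<in> D \<Longrightarrow> J i <+> adic_power k \<subseteq> J (m k) <+> adic_power k \<Longrightarrow>
      J i <+> adic_power k = J (m k) <+> adic_power k"
    by metis
  \<comment> \<open>The common points modulo \<open>\<mm>\<^sup>k\<close>; lying in the smallest coset suffices.\<close>
  define approx where "approx k s \<longleftrightarrow> s \<in> carrier R \<and> (\<forall>i\<in>D. s \<ominus> v i \<in> J i <+> adic_power k)" for k s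
  have approxI: "approx k s" if s: "s \<in> carrier R" "s \<ominus> v (m k) \<in> J (m k) <+> adic_power k" for k s
    unfolding approx_def
  proof (intro conjI ballI s(1))
    fix i assume i: "i \<in> D"
    obtain l where l: "l \<in> D" "J l \<subseteq> J i" "J l \<subseteq> J (m k)" "v l \<ominus> v i \<in> J i" "v l \<ominus> v (m k) \<in> J (m k)"
      using directed[OF i m[of k]] by auto
    interpret Ji: ideal "J i <+> adic_power k" R by (rule sum_ideal[OF i])
    have R: "v i \<in> carrier R" "v l \<in> carrier R" "v (m k) \<in> carrier R" using v i l(1) m by auto
    have "v l \<ominus> v (m k) \<in> J (m k) <+> adic_power k"
      using l(5) add_ideal_upper(1)[OF J[OF m] adic_power_ideal] by auto
    with s(2) have "(s \<ominus> v (m k)) \<ominus> (v l \<ominus> v (m k)) \<in> J (m k) <+> adic_power k"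
      by (rule ideal_diff_closed[OF sum_ideal[OF m]])
    moreover have "(s \<ominus> v (m k)) \<ominus> (v l \<ominus> v (m k)) = s \<ominus> v l"
      using s(1) R by algebra
    moreover have "J (m k) <+> adic_power k = J l <+> adic_power k"
      using minimal[OF l(1) add_ideal_mono[OF l(3) subset_refl]] by (rule sym)
    ultimately have "s \<ominus> v l \<in> J i <+> adic_power k"
      using add_ideal_mono[OF l(2) subset_refl, of "adic_power k"] by auto
    moreover have "v l \<ominus> v i \<in> J i <+> adic_power k"
      using l(4) add_ideal_upper(1)[OF J[OF i] adic_power_ideal] by auto
    ultimately have "(s \<ominus> v l) \<oplus> (v l \<ominus> v i) \<in> J i <+> adic_power k" by simp
    moreover have "(s \<ominus> v l) \<oplus> (v l \<ominus> v i) = s \<ominus> v i" using s(1) R by algebra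
    ultimately show "s \<ominus> v i \<in> J i <+> adic_power k" by simp
  qed
  have "\<exists>f. \<forall>k. approx k (f k) \<and> f (Suc k) \<ominus> f k \<in> adic_power k"
  proof (rule dependent_nat_choice)
    have "v (m 0) \<ominus> v (m 0) = \<zero>" using v[OF m] by (simp add: a_minus_def r_neg)
    then have "v (m 0) \<ominus> v (m 0) \<in> J (m 0) <+> adic_power 0"
      using additive_subgroup.zero_closed[OF ideal.axioms(1)[OF sum_ideal[OF m]]] by simp
    from approxI[OF v[OF m] this] have "approx 0 (v (m 0))" .
    then show "\<exists>s. approx 0 s" by (rule exI)
  next
    fix s k assume s: "approx k s"
    let ?i = "m (Suc k)"
    have "s \<ominus> v ?i \<in> J ?i <+> adic_power k" using s m unfolding approx_def by simp
    then obtain y z where yz: "y \<in> J ?i" "z \<in> adic_power k" "s \<ominus> v ?i = y \<oplus> z"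
      using add_ideal_iff by auto
    have R: "s \<in> carrier R" "v ?i \<in> carrier R" "y \<in> carrier R" "z \<in> carrier R"
      using s v[OF m] yz ideal.Icarr[OF J[OF m]] ideal.Icarr[OF adic_power_ideal]
      unfolding approx_def by auto
    have "(s \<ominus> z) \<ominus> v ?i = (s \<ominus> v ?i) \<ominus> z" using R by algebra
    also have "\<dots> = y" unfolding yz(3) using R by algebra
    finally have "(s \<ominus> z) \<ominus> v ?i \<in> J ?i <+> adic_power (Suc k)"
      using yz(1) add_ideal_upper(1)[OF J[OF m] adic_power_ideal] by auto
    then have "approx (Suc k) (s \<ominus> z)" using approxI R by simp
    moreover have "(s \<ominus> z) \<ominus> s = \<ominus> z" using R by algebra
    then have "(s \<ominus> z) \<ominus> s \<in> adic_power k"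
      using yz(2) additive_subgroup.a_inv_closed[OF ideal.axioms(1)[OF adic_power_ideal]] by simp
    ultimately show "\<exists>s'. approx (Suc k) s' \<and> s' \<ominus> s \<in> adic_power k" by auto
  qed
  then obtain f where f: "\<And>k. approx k (f k)" "\<And>k. f (Suc k) \<ominus> f k \<in> adic_power k" by auto
  then have fR: "\<And>k. f k \<in> carrier R" unfolding approx_def by simp
  obtain a where a: "a \<in> carrier R" "\<And>k. a \<ominus> f k \<in> adic_power k"
    using adic_limit[of f, OF fR f(2)] by auto
  have "a \<ominus> v i \<in> J i" if i: "i \<in> D" for i
  proof (rule ccontr)
    assume "a \<ominus> v i \<notin> J i"
    then obtain k where k: "a \<ominus> v i \<notin> J i <+> adic_power k"
      using krull_closed[OF J[OF i], of "a \<ominus> v i"] a(1) v[OF i] by auto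
    interpret Ji: ideal "J i <+> adic_power k" R by (rule sum_ideal[OF i])
    have "a \<ominus> f k \<in> J i <+> adic_power k"
      using a(2)[of k] add_ideal_upper(2)[OF J[OF i] adic_power_ideal] by auto
    moreover have "f k \<ominus> v i \<in> J i <+> adic_power k"
      using f(1) i unfolding approx_def by simp
    ultimately have "(a \<ominus> f k) \<oplus> (f k \<ominus> v i) \<in> J i <+> adic_power k" by simp
    moreover have "(a \<ominus> f k) \<oplus> (f k \<ominus> v i) = a \<ominus> v i"
      using a(1) fR[of k] v[OF i] by algebra
    ultimately show False using k by simp
  qed
  then show ?thesis using a(1) by auto
qed

end

text \<open>The linear forms in the unknowns \<open>x t\<close>, \<open>t \<in> U\<close>, that involve only finitely many of them,
  described without coefficients: the coordinates of \<open>x\<close> are such forms just as well as linear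
  combinations are. A triple \<open>(f, b, Q)\<close> stands for the congruence of \<open>f x\<close> and \<open>b\<close> modulo \<open>Q\<close>,
  which is an equation for \<open>Q = 0\<close>.\<close>

definition (in ring) finitary_form :: "'t set \<Rightarrow> (('t \<Rightarrow> 'a) \<Rightarrow> 'a) \<Rightarrow> bool"
  where "finitary_form U f \<longleftrightarrow>
    (\<forall>x \<in> U \<rightarrow> carrier R. f x \<in> carrier R) \<and>
    (\<forall>x \<in> U \<rightarrow> carrier R. \<forall>y \<in> U \<rightarrow> carrier R. f (\<lambda>t. x t \<oplus> y t) = f x \<oplus> f y) \<and>
    (\<forall>r \<in> carrier R. \<forall>x \<in> U \<rightarrow> carrier R. f (\<lambda>t. r \<otimes> x t) = r \<otimes> f x) \<and>
    (\<exists>S \<subseteq> U. finite S \<and>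
      (\<forall>x \<in> U \<rightarrow> carrier R. \<forall>y \<in> U \<rightarrow> carrier R. (\<forall>t\<in>S. x t = y t) \<longrightarrow> f x = f y))"

lemma (in ring) finitary_formD:
  assumes "finitary_form U f"
  shows "x \<in> U \<rightarrow> carrier R \<Longrightarrow> f x \<in> carrier R"
    and "x \<in> U \<rightarrow> carrier R \<Longrightarrow> y \<in> U \<rightarrow> carrier R \<Longrightarrow> f (\<lambda>t. x t \<oplus> y t) = f x \<oplus> f y"
    and "r \<in> carrier R \<Longrightarrow> x \<in> U \<rightarrow> carrier R \<Longrightarrow> f (\<lambda>t. r \<otimes> x t) = r \<otimes> f x"
    and "\<exists>S \<subseteq> U. finite S \<and>
      (\<forall>x \<in> U \<rightarrow> carrier R. \<forall>y \<in> U \<rightarrow> carrier R. (\<forall>t\<in>S. x t = y t) \<longrightarrow> f x = f y)"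
  using assms unfolding finitary_form_def by simp_all

lemma (in ring) finitary_form_coordinate: "t \<in> U \<Longrightarrow> finitary_form U (\<lambda>x. x t)"
  unfolding finitary_form_def by (intro conjI ballI exI[of _ "{t}"]) auto

definition (in ring) congruences :: "'t set \<Rightarrow> ((('t \<Rightarrow> 'a) \<Rightarrow> 'a) \<times> 'a \<times> 'a set) set"
  where "congruences U = {(f, b, Q). finitary_form U f \<and> b \<in> carrier R \<and> ideal Q R}"

definition (in ring) solves :: "'t set \<Rightarrow> ('t \<Rightarrow> 'a) \<Rightarrow> ((('t \<Rightarrow> 'a) \<Rightarrow> 'a) \<times> 'a \<times> 'a set) set \<Rightarrow> bool"
  where "solves U x L \<longleftrightarrow> x \<in> U \<rightarrow> carrier R \<and> (\<forall>(f, b, Q)\<in>L. f x \<ominus> b \<in> Q)"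

definition (in ring) homogeneous :: "'t set \<Rightarrow> ('t \<Rightarrow> 'a) \<Rightarrow> ((('t \<Rightarrow> 'a) \<Rightarrow> 'a) \<times> 'a \<times> 'a set) set \<Rightarrow> bool"
  where "homogeneous U x L \<longleftrightarrow> x \<in> U \<rightarrow> carrier R \<and> (\<forall>(f, b, Q)\<in>L. f x \<in> Q)"

lemma (in ring) solves_Un: "solves U x (L \<union> L') \<longleftrightarrow> solves U x L \<and> solves U x L'"
  unfolding solves_def ball_Un by auto

lemma (in ring) solves_mono: "solves U x L' \<Longrightarrow> L \<subseteq> L' \<Longrightarrow> solves U x L"
  unfolding solves_def by auto

text \<open>The values that the solutions of a solvable system assign to one unknown form a coset of this
  ideal, by the two lemmas that follow it.\<close>

lemma (in cring) homogeneous_ideal: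
  assumes L: "L \<subseteq> congruences U" and t: "t \<in> U"
  shows "ideal ((\<lambda>x. x t) ` {x. homogeneous U x L}) R" (is "ideal ?J R")
proof -
  have cl: "finitary_form U f" "ideal Q R" if "(f, b, Q) \<in> L" for f b Q
    using L that unfolding congruences_def by auto
  have smult: "homogeneous U (\<lambda>t. r \<otimes> x t) L" if r: "r \<in> carrier R" and x: "homogeneous U x L" for r x
  proof -
    have xU: "x \<in> U \<rightarrow> carrier R" using x unfolding homogeneous_def by simp
    have "f (\<lambda>t. r \<otimes> x t) \<in> Q" if c: "(f, b, Q) \<in> L" for f b Q
    proof -
      have "f x \<in> Q" using x c unfolding homogeneous_def by auto
      then show ?thesis
        using finitary_formD(3)[OF cl(1)[OF c] r xU] ideal.I_l_closed[OF cl(2)[OF c] _ r] by simp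
    qed
    moreover have "(\<lambda>t. r \<otimes> x t) \<in> U \<rightarrow> carrier R" using xU r by (simp add: Pi_iff)
    ultimately show ?thesis unfolding homogeneous_def by auto
  qed
  have add: "homogeneous U (\<lambda>t. x t \<oplus> y t) L" if x: "homogeneous U x L" and y: "homogeneous U y L" for x y
  proof -
    have xU: "x \<in> U \<rightarrow> carrier R" "y \<in> U \<rightarrow> carrier R" using x y unfolding homogeneous_def by auto
    have "f (\<lambda>t. x t \<oplus> y t) \<in> Q" if c: "(f, b, Q) \<in> L" for f b Q
    proof -
      have "f x \<in> Q" "f y \<in> Q" using x y c unfolding homogeneous_def by auto
      then show ?thesis
        using finitary_formD(2)[OF cl(1)[OF c] xU]
          additive_subgroup.a_closed[OF ideal.axioms(1)[OF cl(2)[OF c]]] by simp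
    qed
    moreover have "(\<lambda>t. x t \<oplus> y t) \<in> U \<rightarrow> carrier R" using xU by (simp add: Pi_iff)
    ultimately show ?thesis unfolding homogeneous_def by auto
  qed
  have inR: "x t \<in> carrier R" if "homogeneous U x L" for x
    using that t unfolding homogeneous_def by auto
  have zero: "homogeneous U (\<lambda>t. \<zero>) L"
    unfolding homogeneous_def
  proof (intro conjI ballI, goal_cases)
    case (2 c)
    obtain f b Q where c: "c = (f, b, Q)" by (cases c)
    have f: "finitary_form U f" "ideal Q R" using cl 2 c by auto
    have "f (\<lambda>t. \<zero> \<otimes> \<zero>) = \<zero> \<otimes> f (\<lambda>t. \<zero>)"
      by (rule finitary_formD(3)[OF f(1)]) auto
    moreover have "f (\<lambda>t. \<zero>) \<in> carrier R" by (rule finitary_formD(1)[OF f(1)]) auto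
    ultimately have "f (\<lambda>t. \<zero>) = \<zero>" by simp
    then show ?case using additive_subgroup.zero_closed[OF ideal.axioms(1)[OF f(2)]] c by simp
  qed auto
  show ?thesis
  proof (rule idealI[OF ring_axioms])
    show "subgroup ?J (add_monoid R)"
    proof (rule add.subgroupI)
      show "?J \<subseteq> carrier R" using inR by auto
      show "?J \<noteq> {}" using zero by auto
    next
      fix a assume "a \<in> ?J"
      then obtain x where x: "homogeneous U x L" "a = x t" by auto
      have "\<ominus> \<one> \<otimes> x t \<in> ?J"
        using smult[OF _ x(1), of "\<ominus> \<one>"] by (intro image_eqI[of _ _ "\<lambda>t. \<ominus> \<one> \<otimes> x t"]) auto
      then show "\<ominus> a \<in> ?J" using inR[OF x(1)] x(2) by (simp add: l_minus)
    next
      fix a b assume "a \<in> ?J" "b \<in> ?J"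
      then obtain x y where "homogeneous U x L" "a = x t" "homogeneous U y L" "b = y t" by auto
      then show "a \<oplus> b \<in> ?J"
        using add by (intro image_eqI[of _ _ "\<lambda>t. x t \<oplus> y t"]) auto
    qed
  next
    fix a r assume "a \<in> ?J" and r: "r \<in> carrier R"
    then obtain x where x: "homogeneous U x L" "a = x t" by auto
    show "r \<otimes> a \<in> ?J"
      using smult[OF r x(1)] x(2) by (intro image_eqI[of _ _ "\<lambda>t. r \<otimes> x t"]) auto
    then show "a \<otimes> r \<in> ?J" using r inR[OF x(1)] x(2) m_comm by simp
  qed
qed

lemma (in cring) solves_add_homogeneous:
  assumes L: "L \<subseteq> congruences U" and x: "solves U x L" and y: "homogeneous U y L"
  shows "solves U (\<lambda>t. x t \<oplus> y t) L"
proof -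
  have "f (\<lambda>t. x t \<oplus> y t) \<ominus> b \<in> Q" if c: "(f, b, Q) \<in> L" for f b Q
  proof -
    have f: "finitary_form U f" "b \<in> carrier R" "ideal Q R" using L c unfolding congruences_def by auto
    have xy: "x \<in> U \<rightarrow> carrier R" "y \<in> U \<rightarrow> carrier R" "f x \<ominus> b \<in> Q" "f y \<in> Q"
      using x y c unfolding solves_def homogeneous_def by auto
    have "f (\<lambda>t. x t \<oplus> y t) \<ominus> b = (f x \<ominus> b) \<oplus> f y"
      unfolding finitary_formD(2)[OF f(1) xy(1,2)]
      using finitary_formD(1)[OF f(1) xy(1)] finitary_formD(1)[OF f(1) xy(2)] f(2) by algebra
    then show ?thesis using xy(3,4) additive_subgroup.a_closed[OF ideal.axioms(1)[OF f(3)]] by simp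
  qed
  moreover have "(\<lambda>t. x t \<oplus> y t) \<in> U \<rightarrow> carrier R"
    using x y unfolding solves_def homogeneous_def by (simp add: Pi_iff)
  ultimately show ?thesis unfolding solves_def by auto
qed

lemma (in cring) homogeneous_diff:
  assumes L: "L \<subseteq> congruences U" and x: "solves U x L" and y: "solves U y L"
  shows "homogeneous U (\<lambda>t. x t \<oplus> \<ominus> \<one> \<otimes> y t) L"
proof -
  have "f (\<lambda>t. x t \<oplus> \<ominus> \<one> \<otimes> y t) \<in> Q" if c: "(f, b, Q) \<in> L" for f b Q
  proof -
    have f: "finitary_form U f" "b \<in> carrier R" "ideal Q R" using L c unfolding congruences_def by auto
    have xy: "x \<in> U \<rightarrow> carrier R" "y \<in> U \<rightarrow> carrier R" "f x \<ominus> b \<in> Q" "f y \<ominus> b \<in> Q"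
      using x y c unfolding solves_def by auto
    have my: "(\<lambda>t. \<ominus> \<one> \<otimes> y t) \<in> U \<rightarrow> carrier R" using xy(2) by auto
    have "f (\<lambda>t. x t \<oplus> \<ominus> \<one> \<otimes> y t) = f x \<oplus> \<ominus> \<one> \<otimes> f y"
      using finitary_formD(2)[OF f(1) xy(1) my] finitary_formD(3)[OF f(1) _ xy(2), of "\<ominus> \<one>"] by simp
    also have "\<dots> = (f x \<ominus> b) \<ominus> (f y \<ominus> b)"
      using finitary_formD(1)[OF f(1) xy(1)] finitary_formD(1)[OF f(1) xy(2)] f(2) by algebra
    finally show ?thesis using ideal_diff_closed[OF f(3) xy(3,4)] by simp
  qed
  moreover have "(\<lambda>t. x t \<oplus> \<ominus> \<one> \<otimes> y t) \<in> U \<rightarrow> carrier R"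
    using x y unfolding solves_def by (simp add: Pi_iff)
  ultimately show ?thesis unfolding homogeneous_def by auto
qed

text \<open>A system of arbitrarily many congruences in arbitrarily many unknowns is solvable if its finite
  subsystems are. Enlarge the system to a maximal one, \<open>M\<close>, whose finite subsystems are solvable. The
  values that solutions of the finite subsystems of \<open>M\<close> assign to an unknown are a directed family of
  cosets, and a point \<open>a\<close> common to all of them can be prescribed as the value of this unknown. By
  maximality this condition belongs to \<open>M\<close>. So \<open>M\<close> itself prescribes the values of all unknowns, and
  these values satisfy each single congruence of \<open>M\<close>.\<close>

proposition (in complete_local_ring) algebraically_compact:
  assumes L: "L \<subseteq> congruences U"
    and fin: "\<And>F. finite F \<Longrightarrow> F \<subseteq> L \<Longrightarrow> \<exists>x. solves U x F"
  shows "\<exists>x. solves U x L"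
proof -
  define \<F> where "\<F> = {L'. L \<subseteq> L' \<and> L' \<subseteq> congruences U \<and>
    (\<forall>F. finite F \<longrightarrow> F \<subseteq> L' \<longrightarrow> (\<exists>x. solves U x F))}"
  have "\<exists>M\<in>\<F>. \<forall>Y\<in>\<F>. M \<subseteq> Y \<longrightarrow> Y = M"
  proof (rule subset_Zorn_nonempty)
    show "\<F> \<noteq> {}" using L fin unfolding \<F>_def by auto
    fix C assume C: "C \<noteq> {}" "subset.chain \<F> C"
    have CF: "Y \<in> \<F>" if "Y \<in> C" for Y using C(2) that unfolding subset.chain_def by auto
    have "\<exists>x. solves U x F" if F: "finite F" "F \<subseteq> \<Union>C" for F
    proof -
      obtain Y where "Y \<in> C" "F \<subseteq> Y" using finite_subset_Union_chain[OF F C] by auto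
      then show ?thesis using CF[of Y] F(1) unfolding \<F>_def by auto
    qed
    moreover have "L \<subseteq> Y \<and> Y \<subseteq> congruences U" if "Y \<in> C" for Y
      using CF[OF that] unfolding \<F>_def by simp
    then have "L \<subseteq> \<Union>C" "\<Union>C \<subseteq> congruences U"
      using C(1) by (fast, fast)
    ultimately show "\<Union>C \<in> \<F>" unfolding \<F>_def by simp
  qed
  then obtain M where "M \<in> \<F>" and maximal: "\<And>Y. Y \<in> \<F> \<Longrightarrow> M \<subseteq> Y \<Longrightarrow> Y = M" by metis
  then have M: "L \<subseteq> M" "M \<subseteq> congruences U" "\<And>F. finite F \<Longrightarrow> F \<subseteq> M \<Longrightarrow> \<exists>x. solves U x F"
    unfolding \<F>_def by auto
  have "\<exists>a\<in>carrier R. ((\<lambda>x. x t), a, {\<zero>}) \<in> M" if t: "t \<in> U" for t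
  proof -
    define D where "D = {F. finite F \<and> F \<subseteq> M}"
    define sol where "sol F = (SOME x. solves U x F)" for F
    have sol: "solves U (sol F) F" if "F \<in> D" for F
      using someI_ex[OF M(3)[of F]] that unfolding sol_def D_def by simp
    have DM: "F \<subseteq> congruences U" if "F \<in> D" for F using that M(2) unfolding D_def by auto
    have solR: "sol F t \<in> carrier R" if "F \<in> D" for F
      using sol[OF that] t unfolding solves_def by auto
    define J where "J F = (\<lambda>x. x t) ` {x. homogeneous U x F}" for F
    have diff: "sol G t \<ominus> sol F t \<in> J F" if F: "F \<in> D" and G: "G \<in> D" and sub: "F \<subseteq> G" for F G
    proof -
      have "solves U (sol G) F" using sol[OF G] sub unfolding solves_def by auto
      from homogeneous_diff[OF DM[OF F] this sol[OF F]]
      have "sol G t \<oplus> \<ominus> \<one> \<otimes> sol F t \<in> J F"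
        unfolding J_def by (intro image_eqI[of _ _ "\<lambda>t. sol G t \<oplus> \<ominus> \<one> \<otimes> sol F t"]) auto
      moreover have "sol G t \<oplus> \<ominus> \<one> \<otimes> sol F t = sol G t \<ominus> sol F t"
        using solR[OF F] solR[OF G] by algebra
      ultimately show ?thesis by simp
    qed
    have anti: "J G \<subseteq> J F" if "F \<subseteq> G" for F G
      using that unfolding J_def homogeneous_def by (intro image_mono) auto
    have "\<exists>a\<in>carrier R. \<forall>F\<in>D. a \<ominus> sol F t \<in> J F"
    proof (rule linearly_compact)
      show "D \<noteq> {}" unfolding D_def by auto
      show "ideal (J F) R" if "F \<in> D" for F
        unfolding J_def by (rule homogeneous_ideal[OF DM[OF that] t])
      show "sol F t \<in> carrier R" if "F \<in> D" for F by (rule solR[OF that])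
      fix F G assume FG: "F \<in> D" "G \<in> D"
      then have "F \<union> G \<in> D" unfolding D_def by simp
      then show "\<exists>H\<in>D. J H \<subseteq> J F \<and> J H \<subseteq> J G \<and> sol H t \<ominus> sol F t \<in> J F \<and> sol H t \<ominus> sol G t \<in> J G"
        by (intro bexI[of _ "F \<union> G"] conjI anti diff FG) auto
    qed
    then obtain a where a: "a \<in> carrier R" "\<And>F. F \<in> D \<Longrightarrow> a \<ominus> sol F t \<in> J F" by auto
    have hit: "\<exists>x. solves U x F \<and> x t = a" if F: "F \<in> D" for F
    proof -
      from a(2)[OF F] obtain y where y: "homogeneous U y F" "a \<ominus> sol F t = y t"
        unfolding J_def by auto
      have "sol F t \<oplus> y t = a"
        unfolding y(2)[symmetric] using a(1) solR[OF F] by algebra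
      with solves_add_homogeneous[OF DM[OF F] sol[OF F] y(1)] show ?thesis
        by (intro exI[of _ "\<lambda>t. sol F t \<oplus> y t"]) auto
    qed
    let ?c = "((\<lambda>x. x t), a, {\<zero>})"
    have "insert ?c M \<in> \<F>"
      unfolding \<F>_def
    proof (intro CollectI conjI allI impI)
      show "L \<subseteq> insert ?c M" using M(1) by auto
      show "insert ?c M \<subseteq> congruences U"
        using M(2) finitary_form_coordinate[OF t] a(1) zeroideal by (auto simp: congruences_def)
      fix F assume F: "finite F" "F \<subseteq> insert ?c M"
      then have "F - {?c} \<in> D" unfolding D_def by auto
      then obtain x where x: "solves U x (F - {?c})" "x t = a" using hit by auto
      have "x t \<ominus> a = \<zero>" using x(2) a(1) by (simp add: r_neg a_minus_def)
      then have "solves U x {?c}" using x(1) unfolding solves_def by simp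
      with x(1) have "solves U x ((F - {?c}) \<union> {?c})" by (simp only: solves_Un)
      then have "solves U x F" by (rule solves_mono) auto
      then show "\<exists>x. solves U x F" by auto
    qed
    then have "?c \<in> M" using maximal[of "insert ?c M"] by auto
    then show ?thesis using a(1) by auto
  qed
  then obtain y where y: "\<And>t. t \<in> U \<Longrightarrow> y t \<in> carrier R" "\<And>t. t \<in> U \<Longrightarrow> ((\<lambda>x. x t), y t, {\<zero>}) \<in> M"
    by metis
  have sat: "f y \<ominus> b \<in> Q" if c: "(f, b, Q) \<in> L" for f b Q
  proof -
    have f: "finitary_form U f" using c L unfolding congruences_def by auto
    obtain S where S: "S \<subseteq> U" "finite S"
      and agree: "\<forall>x \<in> U \<rightarrow> carrier R. \<forall>y \<in> U \<rightarrow> carrier R. (\<forall>t\<in>S. x t = y t) \<longrightarrow> f x = f y"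
      using finitary_formD(4)[OF f] by (elim exE conjE)
    \<comment> \<open>Only the prescribed values of the unknowns that occur in \<open>f\<close> matter.\<close>
    let ?F = "insert (f, b, Q) ((\<lambda>t. ((\<lambda>x. x t), y t, {\<zero>})) ` S)"
    have "finite ?F" "?F \<subseteq> M" using S(1,2) y(2) c M(1) by auto
    then obtain x where x: "solves U x ?F" using M(3) by meson
    then have xU: "x \<in> U \<rightarrow> carrier R" and fx: "f x \<ominus> b \<in> Q" unfolding solves_def by auto
    have "x t = y t" if t: "t \<in> S" for t
    proof -
      have "x t \<ominus> y t = \<zero>" using x t unfolding solves_def by auto
      moreover have "x t \<in> carrier R" "y t \<in> carrier R" using t S(1) xU y(1) by auto
      ultimately show ?thesis by simp
    qed
    then have "\<forall>t\<in>S. x t = y t" by (rule ballI)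
    have "y \<in> U \<rightarrow> carrier R" using y(1) by (rule Pi_I)
    from bspec[OF bspec[OF agree xU] this] have "f x = f y"
      using \<open>\<forall>t\<in>S. x t = y t\<close> by (rule mp)
    then show ?thesis using fx by simp
  qed
  have "\<forall>q\<in>L. case q of (f, b, Q) \<Rightarrow> f y \<ominus> b \<in> Q"
  proof
    fix q assume q: "q \<in> L"
    obtain f b Q where c: "q = (f, b, Q)" by (rule prod_cases3)
    show "case q of (f, b, Q) \<Rightarrow> f y \<ominus> b \<in> Q"
      using sat[of f b Q] q unfolding c by simp
  qed
  moreover have "y \<in> U \<rightarrow> carrier R" using y(1) by (rule Pi_I)
  ultimately have "solves U y L" by (simp add: solves_def)
  then show ?thesis by (rule exI[of _ y])
qed

section \<open>Elements of tensor products\<close>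

lemma tensor_relators_subset:
  assumes "module R A" "module R B"
  shows "tensor_relators R A B \<subseteq> carrier (free_Abelian_group (carrier A \<times> carrier B))"
proof -
  interpret A: module R A by fact
  interpret B: module R B by fact
  have diff: "a - b \<in> carrier (free_Abelian_group Y)"
    if "a \<in> carrier (free_Abelian_group Y)" "b \<in> carrier (free_Abelian_group Y)" for Y a b
    using that keys_diff[of a b] by auto
  show ?thesis
    unfolding tensor_relators_def by (intro Un_least subsetI) (auto intro!: diff simp del: carrier_free_Abelian_group_iff)
qed

lemma tensor_kernel_subgroup:
  assumes "module R A" "module R B"
  shows "subgroup (tensor_kernel R A B) (free_Abelian_group (carrier A \<times> carrier B))"
  unfolding tensor_kernel_def
  by (rule group.generate_is_subgroup[OF group_free_Abelian_group tensor_relators_subset[OF assms]])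

lemma tensor_kernel_minimal:
  assumes "module R A" "module R B"
    and "tensor_relators R A B \<subseteq> L" "0 \<in> L"
    and "\<And>a b. a \<in> L \<Longrightarrow> b \<in> L \<Longrightarrow> a + b \<in> L" "\<And>a. a \<in> L \<Longrightarrow> - a \<in> L"
  shows "tensor_kernel R A B \<subseteq> L"
proof
  fix c assume "c \<in> tensor_kernel R A B"
  then show "c \<in> L"
    unfolding tensor_kernel_def
  proof induction
    case one
    then show ?case using assms(4) by simp
  next
    case (incl h)
    then show ?case using assms(3) by auto
  next
    case (inv h)
    then have "h \<in> carrier (free_Abelian_group (carrier A \<times> carrier B))"
      using subsetD[OF tensor_relators_subset[OF assms(1,2)]] by simp
    then have "inv\<^bsub>free_Abelian_group (carrier A \<times> carrier B)\<^esub> h = - h" by simp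
    then show ?case using inv assms(3,6) by auto
  next
    case (eng h1 h2)
    then show ?case using assms(5) by simp
  qed
qed

definition tensor_cong :: "('a, 'b) ring_scheme \<Rightarrow> ('a, 'x, 'c) module_scheme \<Rightarrow>
    ('a, 'y, 'd) module_scheme \<Rightarrow> ('x \<times> 'y \<Rightarrow>\<^sub>0 int) \<Rightarrow> ('x \<times> 'y \<Rightarrow>\<^sub>0 int) \<Rightarrow> bool"
  where "tensor_cong R A B c c' \<longleftrightarrow> c - c' \<in> tensor_kernel R A B"

locale module_pair = A: module R A + B: module R B
  for R :: "('a, 'b) ring_scheme" and A :: "('a, 'x, 'c) module_scheme" and B :: "('a, 'y, 'd) module_scheme"
begin

lemma kernel_zero: "0 \<in> tensor_kernel R A B"
  using subgroup.one_closed[OF tensor_kernel_subgroup[OF A.module_axioms B.module_axioms]] by simp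

lemma kernel_add: "a \<in> tensor_kernel R A B \<Longrightarrow> b \<in> tensor_kernel R A B \<Longrightarrow> a + b \<in> tensor_kernel R A B"
  using subgroup.m_closed[OF tensor_kernel_subgroup[OF A.module_axioms B.module_axioms]] by simp

lemma kernel_uminus: "a \<in> tensor_kernel R A B \<Longrightarrow> - a \<in> tensor_kernel R A B"
  using subgroup.m_inv_closed[OF tensor_kernel_subgroup[OF A.module_axioms B.module_axioms]]
    subgroup.mem_carrier[OF tensor_kernel_subgroup[OF A.module_axioms B.module_axioms]] by fastforce

lemma kernel_relator: "c \<in> tensor_relators R A B \<Longrightarrow> c \<in> tensor_kernel R A B"
  unfolding tensor_kernel_def by (rule generate.incl)

lemma cong_refl: "tensor_cong R A B c c"
  using kernel_zero by (simp add: tensor_cong_def)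

lemma cong_sym: "tensor_cong R A B c c' \<Longrightarrow> tensor_cong R A B c' c"
  using kernel_uminus[of "c - c'"] by (simp add: tensor_cong_def)

lemma cong_trans [trans]:
  "tensor_cong R A B c c' \<Longrightarrow> tensor_cong R A B c' c'' \<Longrightarrow> tensor_cong R A B c c''"
  using kernel_add[of "c - c'" "c' - c''"] by (simp add: tensor_cong_def)

lemma cong_add:
  "tensor_cong R A B a a' \<Longrightarrow> tensor_cong R A B b b' \<Longrightarrow> tensor_cong R A B (a + b) (a' + b')"
  using kernel_add[of "a - a'" "b - b'"] by (simp add: tensor_cong_def algebra_simps)

lemma cong_sum:
  "(\<And>i. i \<in> I \<Longrightarrow> tensor_cong R A B (f i) (g i)) \<Longrightarrow> tensor_cong R A B (sum f I) (sum g I)"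
  by (induction I rule: infinite_finite_induct) (auto intro: cong_refl cong_add)

lemma cong_add_left:
  assumes "x \<in> carrier A" "x' \<in> carrier A" "y \<in> carrier B"
  shows "tensor_cong R A B (frag_of (x \<oplus>\<^bsub>A\<^esub> x', y)) (frag_of (x, y) + frag_of (x', y))"
proof -
  have "frag_of (x \<oplus>\<^bsub>A\<^esub> x', y) - frag_of (x, y) - frag_of (x', y) \<in> tensor_relators R A B"
    using assms unfolding tensor_relators_def by blast
  then show ?thesis
    using kernel_relator by (simp add: tensor_cong_def diff_diff_eq)
qed

lemma cong_add_right:
  assumes "x \<in> carrier A" "y \<in> carrier B" "y' \<in> carrier B"
  shows "tensor_cong R A B (frag_of (x, y \<oplus>\<^bsub>B\<^esub> y')) (frag_of (x, y) + frag_of (x, y'))"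
proof -
  have "frag_of (x, y \<oplus>\<^bsub>B\<^esub> y') - frag_of (x, y) - frag_of (x, y') \<in> tensor_relators R A B"
    using assms unfolding tensor_relators_def by blast
  then show ?thesis
    using kernel_relator by (simp add: tensor_cong_def diff_diff_eq)
qed

lemma cong_balanced:
  assumes "r \<in> carrier R" "x \<in> carrier A" "y \<in> carrier B"
  shows "tensor_cong R A B (frag_of (r \<odot>\<^bsub>A\<^esub> x, y)) (frag_of (x, r \<odot>\<^bsub>B\<^esub> y))"
  unfolding tensor_cong_def
  by (rule kernel_relator) (use assms in \<open>unfold tensor_relators_def, blast\<close>)

lemma cong_zero_left:
  assumes "y \<in> carrier B"
  shows "tensor_cong R A B (frag_of (\<zero>\<^bsub>A\<^esub>, y)) 0"
  using cong_sym[OF cong_add_left[of "\<zero>\<^bsub>A\<^esub>" "\<zero>\<^bsub>A\<^esub>" y]] assms by (simp add: tensor_cong_def)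

lemma cong_zero_right:
  assumes "x \<in> carrier A"
  shows "tensor_cong R A B (frag_of (x, \<zero>\<^bsub>B\<^esub>)) 0"
  using cong_sym[OF cong_add_right[of x "\<zero>\<^bsub>B\<^esub>" "\<zero>\<^bsub>B\<^esub>"]] assms by (simp add: tensor_cong_def)

lemma cong_finsum_left:
  assumes "finite I" "f \<in> I \<rightarrow> carrier A" "y \<in> carrier B"
  shows "tensor_cong R A B (frag_of (\<Oplus>\<^bsub>A\<^esub>i\<in>I. f i, y)) (\<Sum>i\<in>I. frag_of (f i, y))"
  using assms(1,2)
proof (induction I)
  case empty
  then show ?case using cong_zero_left[OF assms(3)] by simp
next
  case (insert i I)
  then have f: "f i \<in> carrier A" "f \<in> I \<rightarrow> carrier A" by auto
  then have "tensor_cong R A B (frag_of (f i \<oplus>\<^bsub>A\<^esub> (\<Oplus>\<^bsub>A\<^esub>i\<in>I. f i), y))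
      (frag_of (f i, y) + frag_of (\<Oplus>\<^bsub>A\<^esub>i\<in>I. f i, y))"
    by (intro cong_add_left assms(3)) auto
  also have "tensor_cong R A B \<dots> (frag_of (f i, y) + (\<Sum>i\<in>I. frag_of (f i, y)))"
    by (intro cong_add cong_refl insert.IH f)
  finally show ?case using insert.hyps f by simp
qed

lemma cong_finsum_right:
  assumes "finite I" "x \<in> carrier A" "f \<in> I \<rightarrow> carrier B"
  shows "tensor_cong R A B (frag_of (x, \<Oplus>\<^bsub>B\<^esub>i\<in>I. f i)) (\<Sum>i\<in>I. frag_of (x, f i))"
  using assms(1,3)
proof (induction I)
  case empty
  then show ?case using cong_zero_right[OF assms(2)] by simp
next
  case (insert i I)
  then have f: "f i \<in> carrier B" "f \<in> I \<rightarrow> carrier B" by auto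
  then have "tensor_cong R A B (frag_of (x, f i \<oplus>\<^bsub>B\<^esub> (\<Oplus>\<^bsub>B\<^esub>i\<in>I. f i)))
      (frag_of (x, f i) + frag_of (x, \<Oplus>\<^bsub>B\<^esub>i\<in>I. f i))"
    by (intro cong_add_right assms(2)) auto
  also have "tensor_cong R A B \<dots> (frag_of (x, f i) + (\<Sum>i\<in>I. frag_of (x, f i)))"
    by (intro cong_add cong_refl insert.IH f)
  finally show ?case using insert.hyps f by simp
qed

lemma tensor_class_eq:
  assumes "tensor_cong R A B c c'"
  shows "tensor_class R A B c = tensor_class R A B c'"
proof -
  have sub: "tensor_class R A B a \<subseteq> tensor_class R A B b" if "tensor_cong R A B a b" for a b
  proof
    fix z assume "z \<in> tensor_class R A B a"
    then obtain k where k: "k \<in> tensor_kernel R A B" "z = k + a"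
      by (auto simp: tensor_class_def r_coset_def)
    have "k + (a - b) \<in> tensor_kernel R A B"
      using k(1) that kernel_add unfolding tensor_cong_def by simp
    then show "z \<in> tensor_class R A B b"
      unfolding tensor_class_def r_coset_def k(2) by (rule UN_I) simp
  qed
  show ?thesis using sub[OF assms] sub[OF cong_sym[OF assms]] by simp
qed

lemma tensor_class_iff: "c \<in> tensor_class R A B c' \<longleftrightarrow> tensor_cong R A B c c'"
proof
  assume "c \<in> tensor_class R A B c'"
  then show "tensor_cong R A B c c'"
    by (auto simp: tensor_class_def r_coset_def tensor_cong_def)
next
  assume "tensor_cong R A B c c'"
  then show "c \<in> tensor_class R A B c'"
    using tensor_class_eq kernel_zero by (force simp: tensor_class_def r_coset_def)
qed

end

lemma frag_extend_frag_of: "frag_extend (\<lambda>(v, w). frag_of (id v, id w)) c = c"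
  by (induction c rule: frag_induction[OF subset_UNIV]) (auto simp: frag_extend_diff)

lemma tensor_relators_submodule:
  assumes "N \<subseteq> carrier M"
  shows "tensor_relators R A (M\<lparr>carrier := N\<rparr>) \<subseteq> tensor_relators R A M"
  using assms unfolding tensor_relators_def by (simp, blast)

lemma tensor_kernel_submodule:
  assumes "module R A" "module R M" "submodule N R M"
  shows "tensor_kernel R A (M\<lparr>carrier := N\<rparr>) \<subseteq> tensor_kernel R A M"
proof -
  interpret module_pair R A M using assms(1,2) by (simp add: module_pair_def)
  have N: "N \<subseteq> carrier M" using B.submoduleE(1)[OF assms(3)] .
  show ?thesis
  proof (rule tensor_kernel_minimal[OF assms(1) submodule.submodule_is_module[OF assms(3,2)]])
    show "tensor_relators R A (M\<lparr>carrier := N\<rparr>) \<subseteq> tensor_kernel R A M"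
      using tensor_relators_submodule[OF N] kernel_relator by auto
  qed (use kernel_zero kernel_add kernel_uminus in auto)
qed

lemma tensor_map_inclusion:
  assumes "module R A" "module R M" "submodule N R M"
  shows "tensor_map R A M id id (tensor_class R A (M\<lparr>carrier := N\<rparr>) c) = tensor_class R A M c"
proof -
  interpret module_pair R A M using assms(1,2) by (simp add: module_pair_def)
  interpret N: module_pair R A "M\<lparr>carrier := N\<rparr>"
    using assms(1) submodule.submodule_is_module[OF assms(3,2)] by (simp add: module_pair_def)
  let ?Z = "tensor_class R A (M\<lparr>carrier := N\<rparr>) c"
  have same: "tensor_class R A M b = tensor_class R A M c" if "b \<in> ?Z" for b
  proof (rule tensor_class_eq)
    show "tensor_cong R A M b c"
      using that subsetD[OF tensor_kernel_submodule[OF assms]]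
      unfolding N.tensor_class_iff tensor_cong_def by simp
  qed
  have "c \<in> ?Z" unfolding N.tensor_class_iff by (rule N.cong_refl)
  have "(\<Union>b\<in>?Z. tensor_class R A M b) = tensor_class R A M c"
  proof (rule equalityI)
    show "(\<Union>b\<in>?Z. tensor_class R A M b) \<subseteq> tensor_class R A M c"
      by (rule UN_least) (simp only: same subset_refl)
    show "tensor_class R A M c \<subseteq> (\<Union>b\<in>?Z. tensor_class R A M b)"
      using \<open>c \<in> ?Z\<close> by (rule UN_upper)
  qed
  then show ?thesis by (simp only: tensor_map_def frag_extend_frag_of)
qed

text \<open>Statements about the image of \<open>T \<otimes> N\<close> in \<open>T \<otimes> M\<close> become statements about formal sums.\<close>

lemma pure_tensor_in_image_iff:
  assumes "module R A" "module R M" "submodule N R M"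
  shows "pure_tensor R A M x u \<in> tensor_map R A M id id ` carrier (tensor_product R A (M\<lparr>carrier := N\<rparr>))
    \<longleftrightarrow> (\<exists>c. Poly_Mapping.keys c \<subseteq> carrier A \<times> N \<and> tensor_cong R A M (frag_of (x, u)) c)"
proof -
  interpret module_pair R A M using assms(1,2) by (simp add: module_pair_def)
  have "carrier (free_Abelian_group (carrier A \<times> N)) = {c. Poly_Mapping.keys c \<subseteq> carrier A \<times> N}"
    by (rule Set.set_eqI) simp
  then have carr: "carrier (tensor_product R A (M\<lparr>carrier := N\<rparr>)) =
      tensor_class R A (M\<lparr>carrier := N\<rparr>) ` {c. Poly_Mapping.keys c \<subseteq> carrier A \<times> N}"
    unfolding tensor_product_def FactGroup_def RCOSETS_def tensor_class_def
    by (simp add: UNION_singleton_eq_range)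
  have "tensor_class R A M a = tensor_class R A M c \<longleftrightarrow> tensor_cong R A M a c" for a c
    using tensor_class_eq[of a c] tensor_class_iff[of a c] tensor_class_iff[of a a] cong_refl[of a] by auto
  then show ?thesis
    unfolding carr pure_tensor_def image_image tensor_map_inclusion[OF assms]
    by (simp add: image_iff Bex_def)
qed

text \<open>Let the rows of the matrix \<open>\<alpha>\<close> be linear relations between the elements of \<open>S\<close>, and write
  \<open>c\<^sub>t\<close> for the element of \<open>N\<close> in the last assumption. Then \<open>\<Sum>\<^sub>t t \<otimes> c\<^sub>t\<close>, which comes from
  \<open>T \<otimes> N\<close>, equals \<open>s \<otimes> u + \<Sum>\<^sub>i (\<Sum>\<^sub>t \<alpha>\<^sub>i\<^sub>t t) \<otimes> e\<^sub>i = s \<otimes> u\<close>.\<close>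

lemma relations_imp_in_image:
  assumes T: "module R T" and M: "module R M" and N: "submodule N R M"
    and S: "finite S" "S \<subseteq> carrier T" "s \<in> S" and I: "finite I"
    and \<alpha>: "\<And>i t. i \<in> I \<Longrightarrow> t \<in> S \<Longrightarrow> \<alpha> i t \<in> carrier R"
    and e: "\<And>i. i \<in> I \<Longrightarrow> e i \<in> carrier M" and u: "u \<in> carrier M"
    and rel: "\<And>i. i \<in> I \<Longrightarrow> (\<Oplus>\<^bsub>T\<^esub>t\<in>S. \<alpha> i t \<odot>\<^bsub>T\<^esub> t) = \<zero>\<^bsub>T\<^esub>"
    and col: "\<And>t. t \<in> S \<Longrightarrow>
      (if t = s then u else \<zero>\<^bsub>M\<^esub>) \<oplus>\<^bsub>M\<^esub> (\<Oplus>\<^bsub>M\<^esub>i\<in>I. \<alpha> i t \<odot>\<^bsub>M\<^esub> e i) \<in> N"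
  shows "pure_tensor R T M s u \<in> tensor_map R T M id id ` carrier (tensor_product R T (M\<lparr>carrier := N\<rparr>))"
proof -
  interpret module_pair R T M using T M by (simp add: module_pair_def)
  let ?c = "\<lambda>t. (if t = s then u else \<zero>\<^bsub>M\<^esub>) \<oplus>\<^bsub>M\<^esub> (\<Oplus>\<^bsub>M\<^esub>i\<in>I. \<alpha> i t \<odot>\<^bsub>M\<^esub> e i)"
  let ?d = "\<lambda>t. frag_of (t, if t = s then u else \<zero>\<^bsub>M\<^esub>)"
  have "tensor_cong R T M (frag_of (t, ?c t)) (?d t + (\<Sum>i\<in>I. frag_of (\<alpha> i t \<odot>\<^bsub>T\<^esub> t, e i)))"
    if t: "t \<in> S" for t
  proof -
    have tT: "t \<in> carrier T" using t S(2) by auto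
    have f: "(\<lambda>i. \<alpha> i t \<odot>\<^bsub>M\<^esub> e i) \<in> I \<rightarrow> carrier M" using \<alpha> e t by auto
    have "tensor_cong R T M (frag_of (t, ?c t)) (?d t + frag_of (t, \<Oplus>\<^bsub>M\<^esub>i\<in>I. \<alpha> i t \<odot>\<^bsub>M\<^esub> e i))"
      using tT f u by (intro cong_add_right) auto
    also have "tensor_cong R T M \<dots> (?d t + (\<Sum>i\<in>I. frag_of (t, \<alpha> i t \<odot>\<^bsub>M\<^esub> e i)))"
      by (intro cong_add cong_refl cong_finsum_right I tT f)
    also have "tensor_cong R T M \<dots> (?d t + (\<Sum>i\<in>I. frag_of (\<alpha> i t \<odot>\<^bsub>T\<^esub> t, e i)))"
      using \<alpha> e t tT by (intro cong_add cong_refl cong_sum cong_sym[OF cong_balanced]) auto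
    finally show ?thesis .
  qed
  then have "tensor_cong R T M (\<Sum>t\<in>S. frag_of (t, ?c t))
      (\<Sum>t\<in>S. ?d t + (\<Sum>i\<in>I. frag_of (\<alpha> i t \<odot>\<^bsub>T\<^esub> t, e i)))"
    by (rule cong_sum)
  also have "\<dots> = (\<Sum>t\<in>S. ?d t) + (\<Sum>i\<in>I. \<Sum>t\<in>S. frag_of (\<alpha> i t \<odot>\<^bsub>T\<^esub> t, e i))"
    by (simp only: sum.distrib sum.swap[of _ I S])
  also have "tensor_cong R T M \<dots> ((\<Sum>t\<in>S. if t = s then frag_of (s, u) else 0) + (\<Sum>i\<in>I. 0))"
  proof (intro cong_add cong_sum)
    fix t assume "t \<in> S"
    then show "tensor_cong R T M (?d t) (if t = s then frag_of (s, u) else 0)"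
      using cong_refl cong_zero_right[of t] S(2) by auto
  next
    fix i assume i: "i \<in> I"
    have "(\<lambda>t. \<alpha> i t \<odot>\<^bsub>T\<^esub> t) \<in> S \<rightarrow> carrier T" using \<alpha> i S(2) by auto
    from cong_sym[OF cong_finsum_left[OF S(1) this e[OF i]]]
    have "tensor_cong R T M (\<Sum>t\<in>S. frag_of (\<alpha> i t \<odot>\<^bsub>T\<^esub> t, e i)) (frag_of (\<zero>\<^bsub>T\<^esub>, e i))"
      unfolding rel[OF i] .
    also have "tensor_cong R T M \<dots> 0" by (rule cong_zero_left[OF e[OF i]])
    finally show "tensor_cong R T M (\<Sum>t\<in>S. frag_of (\<alpha> i t \<odot>\<^bsub>T\<^esub> t, e i)) 0" .
  qed
  also have "\<dots> = frag_of (s, u)" using S by simp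
  finally have "tensor_cong R T M (frag_of (s, u)) (\<Sum>t\<in>S. frag_of (t, ?c t))" by (rule cong_sym)
  moreover have "(\<Sum>t\<in>S. frag_of (t, ?c t)) \<in> carrier (free_Abelian_group (carrier T \<times> N))"
    using col S(2) by (intro sum_closed_free_Abelian_group) auto
  ultimately show ?thesis
    unfolding pure_tensor_in_image_iff[OF T M N] carrier_free_Abelian_group_iff by auto
qed

text \<open>The map \<open>x \<otimes> m \<mapsto> \<phi>(x) m\<close> from \<open>T \<otimes> M\<close> to \<open>M\<close> sends the image of \<open>T \<otimes> N\<close> into \<open>N\<close>. Below it is the
  homomorphism \<open>h\<close> on formal sums, which vanishes on the relators.\<close>

lemma functional_contracts_image:
  assumes T: "module R T" and M: "module R M" and N: "submodule N R M"
    and \<phi>: "\<phi> \<in> mod_homs R T (self_module R)"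
    and s: "s \<in> carrier T" and u: "u \<in> carrier M"
    and im: "pure_tensor R T M s u \<in> tensor_map R T M id id ` carrier (tensor_product R T (M\<lparr>carrier := N\<rparr>))"
  shows "\<phi> s \<odot>\<^bsub>M\<^esub> u \<in> N"
proof -
  interpret module_pair R T M using T M by (simp add: module_pair_def)
  have \<phi>R: "\<And>x. x \<in> carrier T \<Longrightarrow> \<phi> x \<in> carrier R"
    and \<phi>add: "\<And>x y. x \<in> carrier T \<Longrightarrow> y \<in> carrier T \<Longrightarrow> \<phi> (x \<oplus>\<^bsub>T\<^esub> y) = \<phi> x \<oplus>\<^bsub>R\<^esub> \<phi> y"
    and \<phi>smult: "\<And>r x. r \<in> carrier R \<Longrightarrow> x \<in> carrier T \<Longrightarrow> \<phi> (r \<odot>\<^bsub>T\<^esub> x) = r \<otimes>\<^bsub>R\<^esub> \<phi> x"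
    using \<phi> unfolding mod_homs_def self_module_def by (auto simp: Pi_iff)
  let ?S = "carrier T \<times> carrier M"
  let ?F = "free_Abelian_group ?S"
  have "(\<lambda>(x, y). \<phi> x \<odot>\<^bsub>M\<^esub> y) ` ?S \<subseteq> carrier (add_monoid M)"
    using \<phi>R by auto
  from comm_group.free_Abelian_group_universal[OF B.a_comm_group this]
  obtain h where h: "h \<in> hom ?F (add_monoid M)"
    and "\<And>x. x \<in> ?S \<Longrightarrow> h (frag_of x) = (case x of (x, y) \<Rightarrow> \<phi> x \<odot>\<^bsub>M\<^esub> y)" by auto
  then have h_of: "h (frag_of (x, y)) = \<phi> x \<odot>\<^bsub>M\<^esub> y" if "x \<in> carrier T" "y \<in> carrier M" for x y
    using that by auto
  interpret h: group_hom ?F "add_monoid M" h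
    using h B.a_comm_group group_free_Abelian_group
    by (simp add: group_hom_def group_hom_axioms_def comm_group_def)
  have h_add: "h (a + b) = h a \<oplus>\<^bsub>M\<^esub> h b" if "Poly_Mapping.keys a \<subseteq> ?S" "Poly_Mapping.keys b \<subseteq> ?S" for a b
    using h.hom_mult[of a b] that by simp
  have h_carr: "h a \<in> carrier M" if "Poly_Mapping.keys a \<subseteq> ?S" for a
    using h.hom_closed[of a] that by simp
  have h_zero: "h 0 = \<zero>\<^bsub>M\<^esub>" using h.hom_one by simp
  have h_uminus: "h (- a) = \<ominus>\<^bsub>M\<^esub> h a" if "Poly_Mapping.keys a \<subseteq> ?S" for a
    using h.hom_inv[of a] that by (simp add: a_inv_def)
  have h_diff: "h (a - b) = h a \<ominus>\<^bsub>M\<^esub> h b" if "Poly_Mapping.keys a \<subseteq> ?S" "Poly_Mapping.keys b \<subseteq> ?S" for a b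
    using h_add[of a "- b"] h_uminus[of b] that by (simp add: a_minus_def keys_minus)
  have keys_diffI: "Poly_Mapping.keys (a - b) \<subseteq> ?S" if "Poly_Mapping.keys a \<subseteq> ?S" "Poly_Mapping.keys b \<subseteq> ?S" for a b :: "_ \<Rightarrow>\<^sub>0 int"
    using that keys_diff[of a b] by auto
  define L where "L = {a. Poly_Mapping.keys a \<subseteq> ?S \<and> h a = \<zero>\<^bsub>M\<^esub>}"
  have kernel: "tensor_kernel R T M \<subseteq> L"
  proof (rule tensor_kernel_minimal[OF T M])
    show "0 \<in> L" unfolding L_def using h_zero by simp
    show "a + b \<in> L" if "a \<in> L" "b \<in> L" for a b
      using that h_add[of a b] keys_add[of a b] unfolding L_def by auto
    show "- a \<in> L" if "a \<in> L" for a
      using that h_uminus[of a] unfolding L_def by (simp add: keys_minus)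
    show "tensor_relators R T M \<subseteq> L"
    proof
      fix a assume a: "a \<in> tensor_relators R T M"
      then have "Poly_Mapping.keys a \<subseteq> ?S"
        using subsetD[OF tensor_relators_subset[OF T M]] by simp
      moreover have "h a = \<zero>\<^bsub>M\<^esub>"
        using a unfolding tensor_relators_def
      proof (elim UnE CollectE exE conjE)
        fix x x' y assume a: "a = frag_of (x \<oplus>\<^bsub>T\<^esub> x', y) - frag_of (x, y) - frag_of (x', y)"
          and R: "x \<in> carrier T" "x' \<in> carrier T" "y \<in> carrier M"
        have "h a = (\<phi> x \<odot>\<^bsub>M\<^esub> y \<oplus>\<^bsub>M\<^esub> \<phi> x' \<odot>\<^bsub>M\<^esub> y) \<ominus>\<^bsub>M\<^esub> \<phi> x \<odot>\<^bsub>M\<^esub> y \<ominus>\<^bsub>M\<^esub> \<phi> x' \<odot>\<^bsub>M\<^esub> y"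
          unfolding a using R by (simp add: h_diff keys_diffI h_of \<phi>add \<phi>R B.smult_l_distr)
        then show "h a = \<zero>\<^bsub>M\<^esub>"
          using R \<phi>R by (simp add: a_minus_def B.M.a_ac B.M.r_neg B.M.r_neg1 B.M.r_neg2)
      next
        fix x y y' assume a: "a = frag_of (x, y \<oplus>\<^bsub>M\<^esub> y') - frag_of (x, y) - frag_of (x, y')"
          and R: "x \<in> carrier T" "y \<in> carrier M" "y' \<in> carrier M"
        have "h a = (\<phi> x \<odot>\<^bsub>M\<^esub> y \<oplus>\<^bsub>M\<^esub> \<phi> x \<odot>\<^bsub>M\<^esub> y') \<ominus>\<^bsub>M\<^esub> \<phi> x \<odot>\<^bsub>M\<^esub> y \<ominus>\<^bsub>M\<^esub> \<phi> x \<odot>\<^bsub>M\<^esub> y'"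
          unfolding a using R by (simp add: h_diff keys_diffI h_of \<phi>R B.smult_r_distr)
        then show "h a = \<zero>\<^bsub>M\<^esub>"
          using R \<phi>R by (simp add: a_minus_def B.M.a_ac B.M.r_neg B.M.r_neg1 B.M.r_neg2)
      next
        fix r x y assume a: "a = frag_of (r \<odot>\<^bsub>T\<^esub> x, y) - frag_of (x, r \<odot>\<^bsub>M\<^esub> y)"
          and R: "r \<in> carrier R" "x \<in> carrier T" "y \<in> carrier M"
        have "h a = \<phi> x \<odot>\<^bsub>M\<^esub> (r \<odot>\<^bsub>M\<^esub> y) \<ominus>\<^bsub>M\<^esub> \<phi> x \<odot>\<^bsub>M\<^esub> (r \<odot>\<^bsub>M\<^esub> y)"
          unfolding a using R
          by (simp add: h_diff h_of \<phi>R \<phi>smult B.smult_assoc1[symmetric] A.R.m_comm)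
        then show "h a = \<zero>\<^bsub>M\<^esub>"
          using R \<phi>R by (simp add: a_minus_def B.M.r_neg)
      qed
      ultimately show "a \<in> L" unfolding L_def by simp
    qed
  qed
  obtain c where c: "Poly_Mapping.keys c \<subseteq> carrier T \<times> N" "tensor_cong R T M (frag_of (s, u)) c"
    using im unfolding pure_tensor_in_image_iff[OF T M N] by auto
  have NM: "N \<subseteq> carrier M" using B.submoduleE(1)[OF N] .
  have sub: "carrier T \<times> N \<subseteq> ?S" using NM by auto
  have cS: "Poly_Mapping.keys c \<subseteq> ?S" using c(1) sub by auto
  have "h (frag_of (s, u) - c) = \<zero>\<^bsub>M\<^esub>"
    using c(2) kernel unfolding tensor_cong_def L_def by auto
  then have "h ((frag_of (s, u) - c) + c) = h c"
    using h_add[of "frag_of (s, u) - c" c] keys_diffI[of "frag_of (s, u)" c] cS s u h_carr[OF cS] by simp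
  then have "\<phi> s \<odot>\<^bsub>M\<^esub> u = h c" using h_of[OF s u] by simp
  moreover have "h c \<in> N"
  proof (rule free_Abelian_group_induct[OF c(1), where P = "\<lambda>c. h c \<in> N"])
    show "h 0 \<in> N"
      using h_zero subgroup.one_closed[OF submodule.axioms(1)[OF N]] by simp
  next
    fix a b assume "Poly_Mapping.keys a \<subseteq> carrier T \<times> N" "Poly_Mapping.keys b \<subseteq> carrier T \<times> N"
      and ab: "h a \<in> N" "h b \<in> N"
    then have "h (a - b) = h a \<oplus>\<^bsub>M\<^esub> \<ominus>\<^bsub>M\<^esub> h b"
      using h_diff[of a b] subset_trans[OF _ sub] by (simp add: a_minus_def)
    then show "h (a - b) \<in> N" using ab B.submoduleE(3,5)[OF N] by simp
  next
    fix a assume "a \<in> carrier T \<times> N"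
    then obtain x y where xy: "a = (x, y)" "x \<in> carrier T" "y \<in> N" by auto
    then have "h (frag_of a) = \<phi> x \<odot>\<^bsub>M\<^esub> y" using h_of[of x y] NM by auto
    then show "h (frag_of a) \<in> N" using B.submoduleE(4)[OF N \<phi>R[OF xy(2)] xy(3)] by simp
  qed
  ultimately show ?thesis by simp
qed

section \<open>Linear relations and homomorphisms\<close>

lemma (in cring) self_module_module: "module R (self_module R)"
proof -
  have "abelian_group (self_module R)"
  proof (rule abelian_groupI)
    fix x assume "x \<in> carrier (self_module R)"
    then show "\<exists>y\<in>carrier (self_module R). y \<oplus>\<^bsub>self_module R\<^esub> x = \<zero>\<^bsub>self_module R\<^esub>"
      by (intro bexI[of _ "\<ominus> x"]) (simp_all add: self_module_def l_neg)
  qed (simp_all add: self_module_def a_ac)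
  then show ?thesis
    by (intro moduleI cring_axioms) (simp_all add: self_module_def l_distr r_distr m_assoc)
qed

lemma (in cring) finsum_self_module:
  assumes "f \<in> S \<rightarrow> carrier R"
  shows "finsum (self_module R) f S = finsum R f S"
proof -
  interpret S: module R "self_module R" by (rule self_module_module)
  have carr: "carrier (self_module R) = carrier R" by (simp add: self_module_def)
  show ?thesis
    using assms
  proof (induction S rule: infinite_finite_induct)
    case (infinite S)
    then show ?case using S.finsum_infinite[of S f] finsum_infinite[of S f] by (simp add: self_module_def)
  next
    case empty
    show ?case using S.finsum_empty[of f] by (simp add: self_module_def)
  next
    case (insert t S)
    then have f: "f t \<in> carrier R" "f \<in> S \<rightarrow> carrier R" by auto
    have "finsum (self_module R) f (insert t S) = f t \<oplus>\<^bsub>self_module R\<^esub> finsum (self_module R) f S"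
      using insert.hyps f by (intro S.finsum_insert) (simp_all add: carr)
    also have "\<dots> = f t \<oplus> finsum R f S" using insert.IH f(2) by (simp add: self_module_def)
    also have "\<dots> = finsum R f (insert t S)" using insert.hyps f by (simp add: finsum_insert)
    finally show ?case .
  qed
qed

lemma (in module) finsum_smult_delta:
  assumes "finite S" "t \<in> S" "g \<in> S \<rightarrow> carrier M" "r \<in> carrier R"
  shows "(\<Oplus>\<^bsub>M\<^esub>z\<in>S. (if t = z then r else \<zero>) \<odot>\<^bsub>M\<^esub> g z) = r \<odot>\<^bsub>M\<^esub> g t"
proof -
  have "(\<Oplus>\<^bsub>M\<^esub>z\<in>S. (if t = z then r else \<zero>) \<odot>\<^bsub>M\<^esub> g z) = (\<Oplus>\<^bsub>M\<^esub>z\<in>S. if t = z then r \<odot>\<^bsub>M\<^esub> g z else \<zero>\<^bsub>M\<^esub>)"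
    using assms by (intro M.finsum_cong') (auto simp: Pi_iff)
  also have "\<dots> = r \<odot>\<^bsub>M\<^esub> g t"
    using assms by (intro M.finsum_singleton) (auto simp: Pi_iff)
  finally show ?thesis .
qed

lemma (in module) finsum_smult_add:
  assumes "a \<in> S \<rightarrow> carrier R" "b \<in> S \<rightarrow> carrier R" "g \<in> S \<rightarrow> carrier M"
  shows "(\<Oplus>\<^bsub>M\<^esub>z\<in>S. (a z \<oplus> b z) \<odot>\<^bsub>M\<^esub> g z) =
    (\<Oplus>\<^bsub>M\<^esub>z\<in>S. a z \<odot>\<^bsub>M\<^esub> g z) \<oplus>\<^bsub>M\<^esub> (\<Oplus>\<^bsub>M\<^esub>z\<in>S. b z \<odot>\<^bsub>M\<^esub> g z)"
proof -
  have "(\<Oplus>\<^bsub>M\<^esub>z\<in>S. (a z \<oplus> b z) \<odot>\<^bsub>M\<^esub> g z) = (\<Oplus>\<^bsub>M\<^esub>z\<in>S. a z \<odot>\<^bsub>M\<^esub> g z \<oplus>\<^bsub>M\<^esub> b z \<odot>\<^bsub>M\<^esub> g z)"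
    using assms by (intro M.finsum_cong') (auto simp: Pi_iff smult_l_distr)
  also have "\<dots> = (\<Oplus>\<^bsub>M\<^esub>z\<in>S. a z \<odot>\<^bsub>M\<^esub> g z) \<oplus>\<^bsub>M\<^esub> (\<Oplus>\<^bsub>M\<^esub>z\<in>S. b z \<odot>\<^bsub>M\<^esub> g z)"
    using assms by (intro M.finsum_addf) (auto simp: Pi_iff)
  finally show ?thesis .
qed

definition linear_relations :: "('a, 'b) ring_scheme \<Rightarrow> ('a, 't, 'c) module_scheme \<Rightarrow> ('t set \<times> ('t \<Rightarrow> 'a)) set"
  where "linear_relations R T = {(S, a). finite S \<and> S \<subseteq> carrier T \<and> a \<in> S \<rightarrow> carrier R \<and>
    (\<Oplus>\<^bsub>T\<^esub>t\<in>S. a t \<odot>\<^bsub>T\<^esub> t) = \<zero>\<^bsub>T\<^esub>}"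

lemma (in cring) finitary_form_linear:
  assumes "finite S" "S \<subseteq> U" "a \<in> S \<rightarrow> carrier R"
  shows "finitary_form U (\<lambda>x. \<Oplus>t\<in>S. a t \<otimes> x t)"
  unfolding finitary_form_def
proof (intro conjI ballI)
  have prod: "(\<lambda>t. a t \<otimes> x t) \<in> S \<rightarrow> carrier R" if "x \<in> U \<rightarrow> carrier R" for x
    using that assms by (auto simp: Pi_iff)
  show "(\<Oplus>t\<in>S. a t \<otimes> x t) \<in> carrier R" if "x \<in> U \<rightarrow> carrier R" for x
    using prod[OF that] by (rule finsum_closed)
  show "(\<Oplus>t\<in>S. a t \<otimes> (x t \<oplus> y t)) = (\<Oplus>t\<in>S. a t \<otimes> x t) \<oplus> (\<Oplus>t\<in>S. a t \<otimes> y t)"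
    if x: "x \<in> U \<rightarrow> carrier R" and y: "y \<in> U \<rightarrow> carrier R" for x y
  proof -
    have "(\<Oplus>t\<in>S. a t \<otimes> (x t \<oplus> y t)) = (\<Oplus>t\<in>S. a t \<otimes> x t \<oplus> a t \<otimes> y t)"
      using x y assms by (intro finsum_cong') (auto simp: Pi_iff r_distr)
    also have "\<dots> = (\<Oplus>t\<in>S. a t \<otimes> x t) \<oplus> (\<Oplus>t\<in>S. a t \<otimes> y t)"
      by (rule finsum_addf[OF prod[OF x] prod[OF y]])
    finally show ?thesis .
  qed
  show "(\<Oplus>t\<in>S. a t \<otimes> (r \<otimes> x t)) = r \<otimes> (\<Oplus>t\<in>S. a t \<otimes> x t)"
    if r: "r \<in> carrier R" and x: "x \<in> U \<rightarrow> carrier R" for r x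
  proof -
    have "(\<Oplus>t\<in>S. a t \<otimes> (r \<otimes> x t)) = (\<Oplus>t\<in>S. r \<otimes> (a t \<otimes> x t))"
      using r x assms by (intro finsum_cong') (auto simp: Pi_iff m_lcomm)
    also have "\<dots> = r \<otimes> (\<Oplus>t\<in>S. a t \<otimes> x t)"
      by (rule finsum_rdistr[OF assms(1) r prod[OF x], symmetric])
    finally show ?thesis .
  qed
  have agree: "(\<Oplus>t\<in>S. a t \<otimes> x t) = (\<Oplus>t\<in>S. a t \<otimes> y t)"
    if "y \<in> U \<rightarrow> carrier R" "\<forall>t\<in>S. x t = y t" for x y
  proof (rule finsum_cong'[OF refl prod[OF that(1)]])
    show "a t \<otimes> x t = a t \<otimes> y t" if "t \<in> S" for t
      using bspec[OF \<open>\<forall>t\<in>S. x t = y t\<close> that] by (rule arg_cong)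
  qed
  show "\<exists>S' \<subseteq> U. finite S' \<and> (\<forall>x \<in> U \<rightarrow> carrier R. \<forall>y \<in> U \<rightarrow> carrier R.
      (\<forall>t\<in>S'. x t = y t) \<longrightarrow> (\<Oplus>t\<in>S. a t \<otimes> x t) = (\<Oplus>t\<in>S. a t \<otimes> y t))"
    by (intro exI[of _ S] conjI ballI impI assms(1,2)) (rule agree)
qed

text \<open>Additivity is the relation between \<open>t\<close>, \<open>t'\<close> and \<open>t + t'\<close>, homogeneity the one between \<open>t\<close> and
  \<open>r t\<close>. As these elements need not be distinct, the coefficient functions are written as sums of
  multiples of delta functions, and the sum of such a relation is computed termwise.\<close>

lemma (in module) respects_relations_imp_hom:
  assumes x: "x \<in> carrier M \<rightarrow> carrier R"
    and rel: "\<And>S a. (S, a) \<in> linear_relations R M \<Longrightarrow> (\<Oplus>t\<in>S. a t \<otimes> x t) = \<zero>"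
  shows "x \<in> mod_homs R M (self_module R)"
proof -
  interpret S: module R "self_module R" by (rule self_module_module)
  have xR: "x t \<in> carrier R" if "t \<in> carrier M" for t using x that by auto
  have add: "x (t \<oplus>\<^bsub>M\<^esub> t') = x t \<oplus> x t'" if t: "t \<in> carrier M" "t' \<in> carrier M" for t t'
  proof -
    let ?S = "{t, t', t \<oplus>\<^bsub>M\<^esub> t'}"
    let ?d = "\<lambda>t r z. if t = z then r else \<zero>"
    let ?a = "\<lambda>z. (?d (t \<oplus>\<^bsub>M\<^esub> t') \<one> z \<oplus> ?d t (\<ominus> \<one>) z) \<oplus> ?d t' (\<ominus> \<one>) z"
    have S: "finite ?S" "?S \<subseteq> carrier M" "(\<lambda>z. z) \<in> ?S \<rightarrow> carrier M" using t by auto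
    have d: "?d u r \<in> ?S \<rightarrow> carrier R" if "r \<in> carrier R" for u r using that by auto
    have "(\<Oplus>\<^bsub>M\<^esub>z\<in>?S. ?a z \<odot>\<^bsub>M\<^esub> z) =
        (\<one> \<odot>\<^bsub>M\<^esub> (t \<oplus>\<^bsub>M\<^esub> t') \<oplus>\<^bsub>M\<^esub> (\<ominus> \<one>) \<odot>\<^bsub>M\<^esub> t) \<oplus>\<^bsub>M\<^esub> (\<ominus> \<one>) \<odot>\<^bsub>M\<^esub> t'"
      using S d by (simp add: finsum_smult_add finsum_smult_delta del: finsum_insert)
    also have "\<dots> = \<zero>\<^bsub>M\<^esub>"
      using t by (simp add: smult_l_minus M.a_ac M.r_neg M.r_neg1 M.r_neg2)
    finally have "(?S, ?a) \<in> linear_relations R M"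
      unfolding linear_relations_def using S(1,2) by auto
    from rel[OF this] have "\<zero> = (\<Oplus>z\<in>?S. ?a z \<otimes> x z)" by simp
    also have "\<dots> = (\<Oplus>\<^bsub>self_module R\<^esub>z\<in>?S. ?a z \<odot>\<^bsub>self_module R\<^esub> x z)"
    proof -
      have "(\<lambda>z. ?a z \<otimes> x z) \<in> ?S \<rightarrow> carrier R" using t xR by auto
      from finsum_self_module[OF this] show ?thesis by (simp add: self_module_def)
    qed
    also have "\<dots> = (\<one> \<otimes> x (t \<oplus>\<^bsub>M\<^esub> t') \<oplus> (\<ominus> \<one>) \<otimes> x t) \<oplus> (\<ominus> \<one>) \<otimes> x t'"
    proof -
      have "x \<in> ?S \<rightarrow> carrier (self_module R)" using t xR by (auto simp: self_module_def)
      then have "(\<Oplus>\<^bsub>self_module R\<^esub>z\<in>?S. ?a z \<odot>\<^bsub>self_module R\<^esub> x z) =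
        (\<one> \<odot>\<^bsub>self_module R\<^esub> x (t \<oplus>\<^bsub>M\<^esub> t') \<oplus>\<^bsub>self_module R\<^esub> (\<ominus> \<one>) \<odot>\<^bsub>self_module R\<^esub> x t)
          \<oplus>\<^bsub>self_module R\<^esub> (\<ominus> \<one>) \<odot>\<^bsub>self_module R\<^esub> x t'"
        using S d by (simp add: S.finsum_smult_add S.finsum_smult_delta)
      then show ?thesis by (simp add: self_module_def)
    qed
    finally have zero: "\<zero> = (\<one> \<otimes> x (t \<oplus>\<^bsub>M\<^esub> t') \<oplus> (\<ominus> \<one>) \<otimes> x t) \<oplus> (\<ominus> \<one>) \<otimes> x t'" .
    have R: "x (t \<oplus>\<^bsub>M\<^esub> t') \<in> carrier R" "x t \<in> carrier R" "x t' \<in> carrier R" using t xR by auto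
    have "x (t \<oplus>\<^bsub>M\<^esub> t') =
        ((\<one> \<otimes> x (t \<oplus>\<^bsub>M\<^esub> t') \<oplus> (\<ominus> \<one>) \<otimes> x t) \<oplus> (\<ominus> \<one>) \<otimes> x t') \<oplus> (x t \<oplus> x t')"
      using R by algebra
    also have "\<dots> = \<zero> \<oplus> (x t \<oplus> x t')" by (simp only: zero[symmetric])
    finally show ?thesis using R by simp
  qed
  have smult: "x (r \<odot>\<^bsub>M\<^esub> t) = r \<otimes> x t" if t: "r \<in> carrier R" "t \<in> carrier M" for r t
  proof -
    let ?S = "{t, r \<odot>\<^bsub>M\<^esub> t}"
    let ?d = "\<lambda>t r z. if t = z then r else \<zero>"
    let ?a = "\<lambda>z. ?d (r \<odot>\<^bsub>M\<^esub> t) \<one> z \<oplus> ?d t (\<ominus> r) z"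
    have S: "finite ?S" "?S \<subseteq> carrier M" "(\<lambda>z. z) \<in> ?S \<rightarrow> carrier M" using t by auto
    have d: "?d u r \<in> ?S \<rightarrow> carrier R" if "r \<in> carrier R" for u r using that by auto
    have "(\<Oplus>\<^bsub>M\<^esub>z\<in>?S. ?a z \<odot>\<^bsub>M\<^esub> z) = \<one> \<odot>\<^bsub>M\<^esub> (r \<odot>\<^bsub>M\<^esub> t) \<oplus>\<^bsub>M\<^esub> (\<ominus> r) \<odot>\<^bsub>M\<^esub> t"
      using S d t(1) by (simp add: finsum_smult_add finsum_smult_delta del: finsum_insert)
    also have "\<dots> = \<zero>\<^bsub>M\<^esub>"
      using t by (simp add: smult_l_minus M.r_neg)
    finally have "(?S, ?a) \<in> linear_relations R M"
      unfolding linear_relations_def using S(1,2) t(1) by auto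
    from rel[OF this] have "\<zero> = (\<Oplus>z\<in>?S. ?a z \<otimes> x z)" by simp
    also have "\<dots> = (\<Oplus>\<^bsub>self_module R\<^esub>z\<in>?S. ?a z \<odot>\<^bsub>self_module R\<^esub> x z)"
    proof -
      have "(\<lambda>z. ?a z \<otimes> x z) \<in> ?S \<rightarrow> carrier R" using t xR by auto
      from finsum_self_module[OF this] show ?thesis by (simp add: self_module_def)
    qed
    also have "\<dots> = \<one> \<otimes> x (r \<odot>\<^bsub>M\<^esub> t) \<oplus> (\<ominus> r) \<otimes> x t"
    proof -
      have "x \<in> ?S \<rightarrow> carrier (self_module R)" using t xR by (auto simp: self_module_def)
      then have "(\<Oplus>\<^bsub>self_module R\<^esub>z\<in>?S. ?a z \<odot>\<^bsub>self_module R\<^esub> x z) =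
        \<one> \<odot>\<^bsub>self_module R\<^esub> x (r \<odot>\<^bsub>M\<^esub> t) \<oplus>\<^bsub>self_module R\<^esub> (\<ominus> r) \<odot>\<^bsub>self_module R\<^esub> x t"
        using S d t(1) by (simp add: S.finsum_smult_add S.finsum_smult_delta)
      then show ?thesis by (simp add: self_module_def)
    qed
    finally have zero: "\<zero> = \<one> \<otimes> x (r \<odot>\<^bsub>M\<^esub> t) \<oplus> (\<ominus> r) \<otimes> x t" .
    have R: "x (r \<odot>\<^bsub>M\<^esub> t) \<in> carrier R" "x t \<in> carrier R" using t xR by auto
    have "x (r \<odot>\<^bsub>M\<^esub> t) = (\<one> \<otimes> x (r \<odot>\<^bsub>M\<^esub> t) \<oplus> (\<ominus> r) \<otimes> x t) \<oplus> r \<otimes> x t"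
      using R t(1) by algebra
    also have "\<dots> = \<zero> \<oplus> r \<otimes> x t" by (simp only: zero[symmetric])
    finally show ?thesis using R t(1) by simp
  qed
  show ?thesis
    unfolding mod_homs_def self_module_def using x add smult by simp
qed

text \<open>That no homomorphism maps \<open>s\<close> outside the open ideal \<open>Q\<close> is already forced by finitely many
  linear relations of \<open>T\<close>. For a finite set \<open>F\<close> of relations, let \<open>J F\<close> be the ideal of the values at
  \<open>s\<close> of the functions that respect \<open>F\<close>. As \<open>R/Q\<close> is artinian, \<open>J F + Q\<close> takes a smallest value, at
  \<open>F0\<close> say. If \<open>J F0\<close> had an element \<open>x0 s\<close> outside \<open>Q\<close>, this element would lie in all \<open>J F + Q\<close>, so
  the relations of \<open>T\<close> together with the condition that the value at \<open>s\<close> is \<open>x0 s\<close> modulo \<open>Q\<close> would be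
  finitely satisfiable. By algebraic compactness they would be satisfied by a homomorphism.\<close>

proposition (in complete_local_ring) finite_obstruction:
  fixes T :: "('a, 't, 'c) module_scheme"
  assumes T: "module R T" and s: "s \<in> carrier T"
    and Q: "ideal Q R" "adic_power k \<subseteq> Q"
    and homs: "\<forall>\<psi>\<in>mod_homs R T (self_module R). \<psi> s \<in> Q"
  shows "\<exists>F. finite F \<and> F \<subseteq> linear_relations R T \<and>
    (\<forall>x \<in> carrier T \<rightarrow> carrier R. (\<forall>(S, a)\<in>F. (\<Oplus>t\<in>S. a t \<otimes> x t) = \<zero>) \<longrightarrow> x s \<in> Q)"
proof (rule ccontr)
  assume contra: "\<not> ?thesis"
  interpret T: module R T by (rule T)
  define sys where "sys F = (\<lambda>(S, a). ((\<lambda>x. \<Oplus>t\<in>S. a t \<otimes> x t), \<zero>, {\<zero>})) ` F" for F :: "('t set \<times> ('t \<Rightarrow> 'a)) set"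
  have sys_congr: "sys F \<subseteq> congruences (carrier T)" if "F \<subseteq> linear_relations R T" for F
  proof
    fix c assume "c \<in> sys F"
    then obtain S a where c: "(S, a) \<in> linear_relations R T" "c = ((\<lambda>x. \<Oplus>t\<in>S. a t \<otimes> x t), \<zero>, {\<zero>})"
      using \<open>F \<subseteq> linear_relations R T\<close> unfolding sys_def by auto
    then have "finitary_form (carrier T) (\<lambda>x. \<Oplus>t\<in>S. a t \<otimes> x t)"
      by (intro finitary_form_linear) (simp_all add: linear_relations_def)
    then show "c \<in> congruences (carrier T)"
      unfolding c(2) congruences_def using zeroideal by simp
  qed
  have hom_iff: "homogeneous (carrier T) x (sys F) \<longleftrightarrow>
      x \<in> carrier T \<rightarrow> carrier R \<and> (\<forall>(S, a)\<in>F. (\<Oplus>t\<in>S. a t \<otimes> x t) = \<zero>)" for x F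
    unfolding homogeneous_def sys_def by (simp add: split_beta)
  define J where "J F = (\<lambda>x. x s) ` {x. homogeneous (carrier T) x (sys F)}" for F
  have J_ideal: "ideal (J F) R" if "F \<subseteq> linear_relations R T" for F
    unfolding J_def by (rule homogeneous_ideal[OF sys_congr[OF that] s])
  let ?Fin = "{F. finite F \<and> F \<subseteq> linear_relations R T}"
  have "\<exists>F0\<in>?Fin. \<forall>F\<in>?Fin. J F <+> Q \<subseteq> J F0 <+> Q \<longrightarrow> J F <+> Q = J F0 <+> Q"
  proof (rule minimal_ideal_in_indexed_family[OF Q])
    show "?Fin \<noteq> {}" by auto
    fix F assume "F \<in> ?Fin"
    then have F: "F \<subseteq> linear_relations R T" by simp
    show "ideal (J F <+> Q) R \<and> Q \<subseteq> J F <+> Q"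
      using add_ideals[OF J_ideal[OF F] Q(1)] add_ideal_upper(2)[OF J_ideal[OF F] Q(1)] by simp
  qed
  then obtain F0 where "F0 \<in> ?Fin"
    and minimal: "\<forall>F\<in>?Fin. J F <+> Q \<subseteq> J F0 <+> Q \<longrightarrow> J F <+> Q = J F0 <+> Q"
    by (elim bexE)
  then have F0: "finite F0" "F0 \<subseteq> linear_relations R T" by simp_all
  obtain x0 where x0: "homogeneous (carrier T) x0 (sys F0)" "x0 s \<notin> Q"
    using contra F0 unfolding hom_iff by auto
  have x0R: "x0 s \<in> carrier R" using x0(1) s unfolding homogeneous_def by auto
  have "x0 s \<in> J F0" unfolding J_def using x0(1) by (intro image_eqI[of _ _ x0]) simp_all
  then have x0J: "x0 s \<in> J F0 <+> Q" using add_ideal_upper(1)[OF J_ideal[OF F0(2)] Q(1)] by auto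
  let ?c = "((\<lambda>x. x s), x0 s, Q)"
  have "\<exists>x. solves (carrier T) x (sys (linear_relations R T) \<union> {?c})"
  proof (rule algebraically_compact)
    have "?c \<in> congruences (carrier T)"
      unfolding congruences_def using finitary_form_coordinate[OF s] x0R Q(1) by simp
    then show "sys (linear_relations R T) \<union> {?c} \<subseteq> congruences (carrier T)"
      using sys_congr[OF subset_refl] by simp
    fix G assume G: "finite G" "G \<subseteq> sys (linear_relations R T) \<union> {?c}"
    then have "finite (G - {?c})" "G - {?c} \<subseteq> sys (linear_relations R T)" by auto
    from finite_subset_image[OF this[unfolded sys_def]]
    obtain F where F: "F \<subseteq> linear_relations R T" "finite F" "G - {?c} = sys F"
      unfolding sys_def by auto
    have FF: "F \<union> F0 \<in> ?Fin" using F F0 by auto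
    have "J (F \<union> F0) \<subseteq> J F0"
      unfolding J_def hom_iff by (intro image_mono) auto
    then have "J (F \<union> F0) <+> Q = J F0 <+> Q"
      using bspec[OF minimal FF] add_ideal_mono[OF _ subset_refl] by simp
    then have "x0 s \<in> J (F \<union> F0) <+> Q" using x0J by simp
    then obtain j q where jq: "j \<in> J (F \<union> F0)" "q \<in> Q" "x0 s = j \<oplus> q"
      unfolding add_ideal_iff by (elim bexE)
    then obtain y where "homogeneous (carrier T) y (sys (F \<union> F0))" "j = y s"
      unfolding J_def by (elim imageE CollectE)
    with jq have y: "homogeneous (carrier T) y (sys (F \<union> F0))" "q \<in> Q" "x0 s = y s \<oplus> q"
      by simp_all
    have R: "y s \<in> carrier R" "q \<in> carrier R"
      using y(1,2) s ideal.Icarr[OF Q(1)] unfolding homogeneous_def by auto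
    have "y s \<ominus> x0 s = \<ominus> q" unfolding y(3) using R by algebra
    then have "y s \<ominus> x0 s \<in> Q"
      using y(2) additive_subgroup.a_inv_closed[OF ideal.axioms(1)[OF Q(1)]] by simp
    moreover have yT: "y \<in> carrier T \<rightarrow> carrier R" using y(1) unfolding homogeneous_def by simp
    ultimately have "solves (carrier T) y {?c}" unfolding solves_def by simp
    moreover have "solves (carrier T) y (G - {?c})"
    proof -
      have "\<forall>(S, a)\<in>F. (\<Oplus>t\<in>S. a t \<otimes> y t) = \<zero>" using y(1) unfolding hom_iff by auto
      then show ?thesis
        unfolding F(3) solves_def sys_def using yT by (auto simp: split_beta a_minus_def)
    qed
    ultimately have "solves (carrier T) y ((G - {?c}) \<union> {?c})" by (simp only: solves_Un)
    then have "solves (carrier T) y G" by (rule solves_mono) auto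
    then show "\<exists>x. solves (carrier T) x G" by (rule exI[of _ y])
  qed
  then obtain x where x: "solves (carrier T) x (sys (linear_relations R T))" "solves (carrier T) x {?c}"
    unfolding solves_Un by (elim exE conjE)
  have xT: "x \<in> carrier T \<rightarrow> carrier R" using x(1) unfolding solves_def by simp
  have "x \<in> mod_homs R T (self_module R)"
  proof (rule T.respects_relations_imp_hom[OF xT])
    fix S a assume rel: "(S, a) \<in> linear_relations R T"
    then have "(\<Oplus>t\<in>S. a t \<otimes> x t) \<ominus> \<zero> = \<zero>"
      using x(1) unfolding solves_def sys_def by auto
    moreover have "(\<Oplus>t\<in>S. a t \<otimes> x t) \<in> carrier R"
      using rel xT unfolding linear_relations_def by (intro finsum_closed) (auto simp: Pi_iff)
    ultimately show "(\<Oplus>t\<in>S. a t \<otimes> x t) = \<zero>" by simp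
  qed
  with homs have "x s \<in> Q" by (rule bspec)
  moreover have "x s \<ominus> x0 s \<in> Q" using x(2) unfolding solves_def by simp
  ultimately have "x s \<ominus> (x s \<ominus> x0 s) \<in> Q" by (rule ideal_diff_closed[OF Q(1)])
  moreover have "x s \<in> carrier R" using xT s by auto
  then have "x s \<ominus> (x s \<ominus> x0 s) = x0 s" using x0R by algebra
  ultimately show False using x0(2) by simp
qed

section \<open>A free module built from systems of relations\<close>

lemma (in ring) finsum_in_ideal:
  assumes "ideal Q R" "finite I" "\<And>i. i \<in> I \<Longrightarrow> f i \<in> Q"
  shows "(\<Oplus>i\<in>I. f i) \<in> Q"
proof -
  interpret Q: ideal Q R by fact
  show ?thesis
    using assms(2,3)
  proof (induction I)
    case empty
    show ?case by simp
  next
    case (insert i I)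
    have "(\<Oplus>i\<in>insert i I. f i) = f i \<oplus> (\<Oplus>i\<in>I. f i)"
      using insert.hyps insert.prems Q.Icarr by (intro finsum_insert) auto
    then show ?case using insert by simp
  qed
qed

text \<open>Numbers the basis vectors that belong to the relations; \<open>0\<close> is left for one further vector.\<close>

definition relation_index :: "nat \<Rightarrow> nat \<Rightarrow> nat"
  where "relation_index n i = Suc (prod_encode (n, i))"

lemma relation_index_eq [simp]: "relation_index n i = relation_index n' i' \<longleftrightarrow> n = n' \<and> i = i'"
  by (simp add: relation_index_def)

lemma relation_index_nonzero [simp]: "relation_index n i \<noteq> 0" "0 \<noteq> relation_index n i"
  by (simp_all add: relation_index_def)

text \<open>For each \<open>n\<close>, a finite system of \<open>l n\<close> homogeneous equations, with coefficients \<open>\<alpha> n\<close>, in unknowns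
  indexed by \<open>S n\<close>, one of which is \<open>s n\<close>. All these systems are put into one free module, for which
  the module of polynomials over \<open>R\<close> serves: it has one basis vector for each equation of each
  system, and a further basis vector \<open>e\<^sub>0\<close>.\<close>

locale relation_systems = cring R for R (structure) +
  fixes U :: "'t set" and S :: "nat \<Rightarrow> 't set" and l :: "nat \<Rightarrow> nat"
    and \<alpha> :: "nat \<Rightarrow> nat \<Rightarrow> 't \<Rightarrow> 'a" and s :: "nat \<Rightarrow> 't"
  assumes S: "\<And>n. finite (S n)" "\<And>n. S n \<subseteq> U" "\<And>n. s n \<in> S n"
    and \<alpha>: "\<And>n i t. i < l n \<Longrightarrow> t \<in> S n \<Longrightarrow> \<alpha> n i t \<in> carrier R"
begin

abbreviation P where "P \<equiv> UP R"

definition lin :: "nat \<Rightarrow> nat \<Rightarrow> ('t \<Rightarrow> 'a) \<Rightarrow> 'a"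
  where "lin n i y = (\<Oplus>t\<in>S n. \<alpha> n i t \<otimes> y t)"

text \<open>The submodule of the vectors with a witness is spanned by the columns of the systems, where the
  column of \<open>s n\<close> is increased by \<open>e\<^sub>0\<close>: the coefficient of the column of \<open>t\<close> in the system \<open>n\<close> is
  \<open>x n t\<close>, so the coordinate of an equation is its value at \<open>x n\<close>, and \<open>e\<^sub>0\<close> collects the \<open>x n (s n)\<close>. In the
  quotient, the vector \<open>e\<^sub>0\<close> is thus identified, for all \<open>n\<close> at once, with the negative of the column
  of \<open>s n\<close>. The bound \<open>m\<close> says that only finitely many systems contribute.\<close>

definition witness :: "(nat \<Rightarrow> 'a) \<Rightarrow> (nat \<Rightarrow> 't \<Rightarrow> 'a) \<Rightarrow> nat \<Rightarrow> bool"
  where "witness v x m \<longleftrightarrow> (\<forall>n. x n \<in> U \<rightarrow> carrier R) \<and> (\<forall>n\<ge>m. \<forall>t\<in>U. x n t = \<zero>) \<and>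
    (\<forall>n. \<forall>i<l n. up_ring.coeff P v (relation_index n i) = lin n i (x n)) \<and>
    up_ring.coeff P v 0 = (\<Oplus>n\<in>{..<m}. x n (s n))"

definition image_module :: "(nat \<Rightarrow> 'a) set"
  where "image_module = {v \<in> carrier P. \<exists>x m. witness v x m}"

sublocale P: UP_cring R P
  by (simp add: UP_cring_def cring_axioms)

lemma P_module: "module R P"
  using P.UP_algebra by (rule algebra.module)

lemma s_in: "s n \<in> U" using S by auto

lemma lin_add:
  assumes "i < l n" "x \<in> U \<rightarrow> carrier R" "y \<in> U \<rightarrow> carrier R"
  shows "lin n i (\<lambda>t. x t \<oplus> y t) = lin n i x \<oplus> lin n i y"
proof -
  have "x \<in> S n \<rightarrow> carrier R" "y \<in> S n \<rightarrow> carrier R" using assms(2,3) S(2) by (auto simp: Pi_iff)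
  then have R: "x t \<in> carrier R" "y t \<in> carrier R" if "t \<in> S n" for t using that by auto
  have "lin n i (\<lambda>t. x t \<oplus> y t) = (\<Oplus>t\<in>S n. \<alpha> n i t \<otimes> x t \<oplus> \<alpha> n i t \<otimes> y t)"
    unfolding lin_def using \<alpha>[OF assms(1)] R by (intro finsum_cong') (simp_all add: r_distr)
  also have "\<dots> = lin n i x \<oplus> lin n i y"
    unfolding lin_def using \<alpha>[OF assms(1)] R by (intro finsum_addf) simp_all
  finally show ?thesis .
qed

lemma lin_smult:
  assumes "i < l n" "x \<in> U \<rightarrow> carrier R" "r \<in> carrier R"
  shows "lin n i (\<lambda>t. r \<otimes> x t) = r \<otimes> lin n i x"
proof -
  have "x \<in> S n \<rightarrow> carrier R" using assms(2) S(2) by (auto simp: Pi_iff)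
  then have R: "x t \<in> carrier R" if "t \<in> S n" for t using that by auto
  have "lin n i (\<lambda>t. r \<otimes> x t) = (\<Oplus>t\<in>S n. r \<otimes> (\<alpha> n i t \<otimes> x t))"
    unfolding lin_def using \<alpha>[OF assms(1)] R assms(3) by (intro finsum_cong') (simp_all add: m_lcomm)
  also have "\<dots> = r \<otimes> lin n i x"
    unfolding lin_def using \<alpha>[OF assms(1)] R assms(3) S(1)[of n]
    by (intro finsum_rdistr[symmetric]) simp_all
  finally show ?thesis .
qed

lemma witness_extend:
  assumes "witness v x m" "m \<le> m'"
  shows "witness v x m'"
proof -
  have x: "x n \<in> U \<rightarrow> carrier R" for n using assms(1) unfolding witness_def by simp
  have zero: "x n t = \<zero>" if "m \<le> n" "t \<in> U" for n t using assms(1) that unfolding witness_def by simp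
  have "(\<Oplus>n\<in>{..<m}. x n (s n)) = (\<Oplus>n\<in>{..<m'}. x n (s n))"
    using assms(2) x s_in zero by (intro add.finprod_mono_neutral_cong_left) (auto simp: Pi_iff)
  then show ?thesis using assms unfolding witness_def by simp
qed

lemma witness_add:
  assumes v: "v \<in> carrier P" "witness v x m" and w: "w \<in> carrier P" "witness w y m"
  shows "witness (v \<oplus>\<^bsub>P\<^esub> w) (\<lambda>n t. x n t \<oplus> y n t) m"
proof -
  have x: "x n \<in> U \<rightarrow> carrier R" and y: "y n \<in> U \<rightarrow> carrier R" for n
    using v(2) w(2) unfolding witness_def by simp_all
  then have R: "x n t \<in> carrier R" "y n t \<in> carrier R" if "t \<in> U" for n t using that by (auto simp: Pi_iff)
  have "(\<Oplus>n\<in>{..<m}. x n (s n) \<oplus> y n (s n)) = (\<Oplus>n\<in>{..<m}. x n (s n)) \<oplus> (\<Oplus>n\<in>{..<m}. y n (s n))"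
    using R s_in by (intro finsum_addf) simp_all
  moreover have "(\<lambda>t. x n t \<oplus> y n t) \<in> U \<rightarrow> carrier R" for n using R by simp
  ultimately show ?thesis
    using v w lin_add[OF _ x y] unfolding witness_def by simp
qed

lemma witness_smult:
  assumes v: "v \<in> carrier P" "witness v x m" and r: "r \<in> carrier R"
  shows "witness (r \<odot>\<^bsub>P\<^esub> v) (\<lambda>n t. r \<otimes> x n t) m"
proof -
  have x: "x n \<in> U \<rightarrow> carrier R" for n
    using v(2) unfolding witness_def by simp
  then have R: "x n t \<in> carrier R" if "t \<in> U" for n t using that by (auto simp: Pi_iff)
  have "(\<Oplus>n\<in>{..<m}. r \<otimes> x n (s n)) = r \<otimes> (\<Oplus>n\<in>{..<m}. x n (s n))"
    using R s_in r by (intro finsum_rdistr[symmetric]) simp_all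
  moreover have "(\<lambda>t. r \<otimes> x n t) \<in> U \<rightarrow> carrier R" for n using R r by simp
  ultimately show ?thesis
    using v r lin_smult[OF _ x r] unfolding witness_def by simp
qed

lemma image_moduleI: "v \<in> carrier P \<Longrightarrow> witness v x m \<Longrightarrow> v \<in> image_module"
  unfolding image_module_def by (intro CollectI conjI exI)

lemma image_moduleE:
  assumes "v \<in> image_module"
  obtains x m where "v \<in> carrier P" "witness v x m"
  using assms unfolding image_module_def by (elim CollectE conjE exE)

lemma image_module_submodule: "submodule image_module R P"
proof -
  have smult: "r \<odot>\<^bsub>P\<^esub> v \<in> image_module" if r: "r \<in> carrier R" and v: "v \<in> image_module" for r v
  proof -
    obtain x m where "v \<in> carrier P" "witness v x m" using v by (rule image_moduleE)
    then show ?thesis using r by (intro image_moduleI[OF _ witness_smult]) simp_all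
  qed
  show ?thesis
  proof (rule module.submoduleI[OF P_module])
    show "image_module \<subseteq> carrier P" unfolding image_module_def by auto
    have "lin n i (\<lambda>_. \<zero>) = \<zero>" if "i < l n" for n i
      using lin_smult[OF that, of "\<lambda>_. \<zero>" \<zero>] S(1) \<alpha>[OF that] unfolding lin_def by simp
    then have "witness \<zero>\<^bsub>P\<^esub> (\<lambda>_ _. \<zero>) 0" unfolding witness_def by simp
    then show "\<zero>\<^bsub>P\<^esub> \<in> image_module" by (intro image_moduleI) simp_all
    show "v \<oplus>\<^bsub>P\<^esub> w \<in> image_module" if vw: "v \<in> image_module" "w \<in> image_module" for v w
    proof -
      obtain x m where v: "v \<in> carrier P" "witness v x m" using vw(1) by (rule image_moduleE)
      obtain y m' where w: "w \<in> carrier P" "witness w y m'" using vw(2) by (rule image_moduleE)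
      have "witness v x (max m m')" "witness w y (max m m')"
        using witness_extend[OF v(2)] witness_extend[OF w(2)] by simp_all
      from witness_add[OF v(1) this(1) w(1) this(2)] show ?thesis
        using v(1) w(1) by (intro image_moduleI) simp_all
    qed
    show "\<ominus>\<^bsub>P\<^esub> v \<in> image_module" if v: "v \<in> image_module" for v
    proof -
      have "v \<in> carrier P" using v unfolding image_module_def by simp
      then have "(\<ominus> \<one>) \<odot>\<^bsub>P\<^esub> v = \<ominus>\<^bsub>P\<^esub> v"
        using module.smult_l_minus[OF P_module, of \<one> v] by simp
      then show ?thesis using smult[OF _ v, of "\<ominus> \<one>"] by simp
    qed
  qed (rule smult)
qed

definition unit_vec :: "nat \<Rightarrow> nat \<Rightarrow> 'a" where "unit_vec k = up_ring.monom P \<one> k"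

lemma unit_vec_closed [simp]: "unit_vec k \<in> carrier P"
  by (simp add: unit_vec_def)

lemma coeff_unit_vec [simp]: "up_ring.coeff P (unit_vec k) j = (if k = j then \<one> else \<zero>)"
  by (simp add: unit_vec_def)

lemma column_in_image_module:
  assumes t: "t \<in> S n"
  shows "(if t = s n then unit_vec 0 else \<zero>\<^bsub>P\<^esub>) \<oplus>\<^bsub>P\<^esub>
    (\<Oplus>\<^bsub>P\<^esub>i\<in>{..<l n}. \<alpha> n i t \<odot>\<^bsub>P\<^esub> unit_vec (relation_index n i)) \<in> image_module" (is "?e \<oplus>\<^bsub>P\<^esub> ?c \<in> _")
proof -
  have terms: "(\<lambda>i. \<alpha> n i t \<odot>\<^bsub>P\<^esub> unit_vec (relation_index n i)) \<in> {..<l n} \<rightarrow> carrier P"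
    using \<alpha> t by simp
  have c: "?c \<in> carrier P" by (rule P.P.finsum_closed[OF terms])
  have e: "?e \<in> carrier P" by simp
  have coeff_c: "up_ring.coeff P ?c k = (\<Oplus>i\<in>{..<l n}. if relation_index n i = k then \<alpha> n i t else \<zero>)" for k
  proof -
    have "up_ring.coeff P ?c k = (\<Oplus>i\<in>{..<l n}. up_ring.coeff P (\<alpha> n i t \<odot>\<^bsub>P\<^esub> unit_vec (relation_index n i)) k)"
      by (rule P.coeff_finsum[OF finite_lessThan terms])
    also have "\<dots> = (\<Oplus>i\<in>{..<l n}. if relation_index n i = k then \<alpha> n i t else \<zero>)"
      using \<alpha> t by (intro finsum_cong') simp_all
    finally show ?thesis .
  qed
  define x where "x n' t' = (if n' = n \<and> t' = t then \<one> else \<zero>)" for n' t'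
  have "up_ring.coeff P (?e \<oplus>\<^bsub>P\<^esub> ?c) (relation_index n' i) = lin n' i (x n')" if i: "i < l n'" for n' i
  proof (cases "n' = n")
    case False
    have "up_ring.coeff P ?c (relation_index n' i) = (\<Oplus>i\<in>{..<l n}. \<zero>)"
      unfolding coeff_c using False by (intro finsum_cong') simp_all
    then have "up_ring.coeff P (?e \<oplus>\<^bsub>P\<^esub> ?c) (relation_index n' i) = \<zero>"
      using c by simp
    moreover have "lin n' i (x n') = (\<Oplus>t\<in>S n'. \<zero>)"
      unfolding lin_def using False \<alpha>[OF i] by (intro finsum_cong') (simp_all add: x_def)
    ultimately show ?thesis by simp
  next
    case True
    have "up_ring.coeff P ?c (relation_index n i) = (\<Oplus>j\<in>{..<l n}. if i = j then \<alpha> n j t else \<zero>)"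
      unfolding coeff_c using \<alpha> t by (intro finsum_cong') auto
    also have "\<dots> = \<alpha> n i t"
      using \<alpha> t i True by (intro finsum_singleton) auto
    finally have "up_ring.coeff P (?e \<oplus>\<^bsub>P\<^esub> ?c) (relation_index n' i) = \<alpha> n i t"
      using c True \<alpha> t i by simp
    moreover have "lin n i (x n) = (\<Oplus>t'\<in>S n. if t = t' then \<alpha> n i t' else \<zero>)"
      unfolding lin_def using \<alpha>[of i n] i True by (intro finsum_cong') (auto simp: x_def)
    moreover have "\<dots> = \<alpha> n i t"
      using \<alpha>[of i n] i True t S(1) by (intro finsum_singleton) auto
    ultimately show ?thesis using True by simp
  qed
  moreover have "up_ring.coeff P (?e \<oplus>\<^bsub>P\<^esub> ?c) 0 = (\<Oplus>n'\<in>{..<Suc n}. x n' (s n'))"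
  proof -
    have "up_ring.coeff P ?c 0 = (\<Oplus>i\<in>{..<l n}. \<zero>)"
      unfolding coeff_c by (intro finsum_cong') simp_all
    then have "up_ring.coeff P (?e \<oplus>\<^bsub>P\<^esub> ?c) 0 = (if t = s n then \<one> else \<zero>)"
      using c by simp
    moreover have "(\<Oplus>n'\<in>{..<Suc n}. x n' (s n')) =
        (\<Oplus>n'\<in>{..<Suc n}. if n = n' then (if t = s n' then \<one> else \<zero>) else \<zero>)"
      by (intro finsum_cong') (auto simp: x_def)
    moreover have "\<dots> = (if t = s n then \<one> else \<zero>)"
      by (intro finsum_singleton) auto
    ultimately show ?thesis by simp
  qed
  moreover have "x n' \<in> U \<rightarrow> carrier R" for n' by (simp add: x_def)
  moreover have "x n' t' = \<zero>" if "Suc n \<le> n'" for n' t' using that by (simp add: x_def)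
  ultimately have "witness (?e \<oplus>\<^bsub>P\<^esub> ?c) x (Suc n)" unfolding witness_def by simp
  moreover have "?e \<oplus>\<^bsub>P\<^esub> ?c \<in> carrier P" using e c by simp
  ultimately show ?thesis by (intro image_moduleI)
qed

text \<open>If \<open>r e\<^sub>0\<close> lies in the submodule, then its witness solves all systems, and \<open>r\<close> is the sum of the
  values of these solutions at the elements \<open>s n\<close>.\<close>

lemma multiple_of_zeroth_unit_vec:
  assumes Q: "ideal Q R"
    and obstruction: "\<And>n x. x \<in> U \<rightarrow> carrier R \<Longrightarrow> (\<And>i. i < l n \<Longrightarrow> lin n i x = \<zero>) \<Longrightarrow> x (s n) \<in> Q"
    and r: "r \<in> carrier R" "r \<odot>\<^bsub>P\<^esub> unit_vec 0 \<in> image_module"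
  shows "r \<in> Q"
proof -
  obtain x m where w: "witness (r \<odot>\<^bsub>P\<^esub> unit_vec 0) x m"
    using r(2) by (rule image_moduleE)
  have "lin n i (x n) = \<zero>" if "i < l n" for n i
    using w that r(1) unfolding witness_def by (simp del: coeff_unit_vec) simp
  moreover have "x n \<in> U \<rightarrow> carrier R" for n using w unfolding witness_def by simp
  ultimately have "x n (s n) \<in> Q" for n by (intro obstruction)
  then have "(\<Oplus>n\<in>{..<m}. x n (s n)) \<in> Q" by (intro finsum_in_ideal[OF Q]) simp_all
  moreover have "r = (\<Oplus>n\<in>{..<m}. x n (s n))"
    using w r(1) unfolding witness_def by simp
  ultimately show ?thesis by simp
qed

end

text \<open>Together with the next two lemmas, this moves the free module into every type that has room for
  \<open>R\<close>: a polynomial is a finite list of elements of the infinite set \<open>R\<close>.\<close>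

lemma transport_module:
  assumes P: "module R P" and h: "inj_on h (carrier P)"
  obtains M :: "('a, 'm) module" where "module R M" "carrier M = h ` carrier P" "h \<in> mod_homs R P M"
proof -
  interpret P: module R P by (rule P)
  define g where "g = inv_into (carrier P) h"
  have g [simp]: "g (h x) = x" if "x \<in> carrier P" for x
    unfolding g_def using h that by (rule inv_into_f_f)
  define M :: "('a, 'm) module" where
    "M = \<lparr>carrier = h ` carrier P, monoid.mult = undefined, one = undefined, ring.zero = h \<zero>\<^bsub>P\<^esub>,
      ring.add = \<lambda>x y. h (g x \<oplus>\<^bsub>P\<^esub> g y), smult = \<lambda>r x. h (r \<odot>\<^bsub>P\<^esub> g x)\<rparr>"
  have carr: "carrier M = h ` carrier P" by (simp add: M_def)
  have add: "h x \<oplus>\<^bsub>M\<^esub> h y = h (x \<oplus>\<^bsub>P\<^esub> y)" if "x \<in> carrier P" "y \<in> carrier P" for x y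
    using that by (simp add: M_def)
  have smult: "r \<odot>\<^bsub>M\<^esub> h x = h (r \<odot>\<^bsub>P\<^esub> x)" if "x \<in> carrier P" for r x
    using that by (simp add: M_def)
  have zero: "\<zero>\<^bsub>M\<^esub> = h \<zero>\<^bsub>P\<^esub>" by (simp add: M_def)
  have "abelian_group M"
  proof (rule abelian_groupI)
    fix x assume "x \<in> carrier M"
    then obtain a where a: "a \<in> carrier P" "x = h a" unfolding carr by auto
    then show "\<exists>y\<in>carrier M. y \<oplus>\<^bsub>M\<^esub> x = \<zero>\<^bsub>M\<^esub>"
      unfolding carr zero by (intro bexI[of _ "h (\<ominus>\<^bsub>P\<^esub> a)"]) (simp_all add: add P.M.l_neg)
  qed (auto simp: carr zero add P.M.a_ac)
  then have "module R M"
    by (intro moduleI P.R.cring_axioms)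
      (auto simp: carr add smult P.smult_l_distr P.smult_r_distr P.smult_assoc1)
  moreover have "h \<in> mod_homs R P M"
    unfolding mod_homs_def by (auto simp: carr add smult)
  ultimately show thesis using that carr by simp
qed

lemma (in cring) polynomials_inject:
  assumes "infinite (carrier R)"
  obtains h :: "(nat \<Rightarrow> 'a) \<Rightarrow> 'a" where "inj_on h (carrier (UP R))" "h ` carrier (UP R) \<subseteq> carrier R"
proof -
  have up: "carrier (UP R) = up R" by (simp add: UP_def)
  define N where "N v = (SOME n. bound \<zero> n v)" for v
  define code where "code v = map v [0..<Suc (N v)]" for v :: "nat \<Rightarrow> 'a"
  have N: "v k = \<zero>" if "v \<in> up R" "N v < k" for v k
  proof -
    have "\<exists>n. bound \<zero> n v" using that(1) by (rule bound_upD)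
    then have "bound \<zero> (N v) v" unfolding N_def by (rule someI_ex)
    then show ?thesis using that(2) by (simp add: bound_def)
  qed
  have inj: "inj_on code (up R)"
  proof (rule inj_onI)
    fix v w assume vw: "v \<in> up R" "w \<in> up R" "code v = code w"
    then have len: "N v = N w" unfolding code_def by (metis diff_zero length_map length_upt nat.inject)
    show "v = w"
    proof
      fix k
      show "v k = w k"
      proof (cases "k \<le> N v")
        case True
        then have "v k = code v ! k" "w k = code w ! k" using len by (simp_all add: code_def del: upt_Suc)
        then show ?thesis using vw(3) by simp
      next
        case False
        then show ?thesis using N[OF vw(1)] N[OF vw(2)] len by simp
      qed
    qed
  qed
  have into: "code ` up R \<subseteq> lists (carrier R)"
    unfolding code_def by (auto simp: mem_upD)
  obtain f where f: "bij_betw f (lists (carrier R)) (carrier R)"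
    using lists_infinite_bij_betw[OF assms] by auto
  show thesis
  proof (rule that)
    show "inj_on (f \<circ> code) (carrier (UP R))"
      unfolding up using inj inj_on_subset[OF bij_betw_imp_inj_on[OF f] into] by (rule comp_inj_on)
    show "(f \<circ> code) ` carrier (UP R) \<subseteq> carrier R"
      unfolding up image_comp[symmetric] using into bij_betw_imp_surj_on[OF f] by blast
  qed
qed

lemma (in ring) char_zero_infinite:
  assumes "has_char R 0"
  shows "infinite (carrier R)"
proof -
  have "inj (\<lambda>k::nat. add_pow R k \<one>)"
  proof (rule linorder_injI)
    fix j k :: nat assume jk: "j < k"
    have "add_pow R k \<one> = add_pow R j \<one> \<oplus> add_pow R (k - j) \<one>"
      using jk by (simp add: add.nat_pow_mult)
    moreover have "add_pow R (k - j) \<one> \<noteq> \<zero>"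
      using assms jk unfolding has_char_def by simp
    ultimately show "add_pow R j \<one> \<noteq> add_pow R k \<one>"
      using add.r_cancel_one'[of "add_pow R j \<one>" "add_pow R (k - j) \<one>"] by auto
  qed
  moreover have "range (\<lambda>k::nat. add_pow R k \<one>) \<subseteq> carrier R" by auto
  ultimately show ?thesis by (meson finite_subset range_inj_infinite)
qed

section \<open>The test ideal and the trace ideal\<close>

lemma mod_homD:
  assumes "f \<in> mod_homs R A B"
  shows "x \<in> carrier A \<Longrightarrow> f x \<in> carrier B"
    and "x \<in> carrier A \<Longrightarrow> y \<in> carrier A \<Longrightarrow> f (x \<oplus>\<^bsub>A\<^esub> y) = f x \<oplus>\<^bsub>B\<^esub> f y"
    and "r \<in> carrier R \<Longrightarrow> x \<in> carrier A \<Longrightarrow> f (r \<odot>\<^bsub>A\<^esub> x) = r \<odot>\<^bsub>B\<^esub> f x"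
  using assms by (auto simp: mod_homs_def Pi_iff)

lemma mod_hom_zero:
  assumes "module R A" "module R B" "f \<in> mod_homs R A B"
  shows "f \<zero>\<^bsub>A\<^esub> = \<zero>\<^bsub>B\<^esub>"
proof -
  interpret module_pair R A B using assms(1,2) by (simp add: module_pair_def)
  have "f (\<zero>\<^bsub>R\<^esub> \<odot>\<^bsub>A\<^esub> \<zero>\<^bsub>A\<^esub>) = \<zero>\<^bsub>R\<^esub> \<odot>\<^bsub>B\<^esub> f \<zero>\<^bsub>A\<^esub>"
    by (intro mod_homD(3)[OF assms(3)]) simp_all
  then show ?thesis using mod_homD(1)[OF assms(3), of "\<zero>\<^bsub>A\<^esub>"] by simp
qed

lemma mod_hom_finsum:
  assumes "module R A" "module R B" "f \<in> mod_homs R A B" "finite I" "g \<in> I \<rightarrow> carrier A"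
  shows "f (\<Oplus>\<^bsub>A\<^esub>i\<in>I. g i) = (\<Oplus>\<^bsub>B\<^esub>i\<in>I. f (g i))"
proof -
  interpret module_pair R A B using assms(1,2) by (simp add: module_pair_def)
  show ?thesis
    using assms(4,5)
  proof (induction I)
    case empty
    show ?case using mod_hom_zero[OF assms(1-3)] by simp
  next
    case (insert i I)
    then have g: "g i \<in> carrier A" "g \<in> I \<rightarrow> carrier A" by auto
    then have fg: "f (g i) \<in> carrier B" "(\<lambda>i. f (g i)) \<in> I \<rightarrow> carrier B"
      using mod_homD(1)[OF assms(3)] by auto
    have "f (\<Oplus>\<^bsub>A\<^esub>i\<in>insert i I. g i) = f (g i) \<oplus>\<^bsub>B\<^esub> f (\<Oplus>\<^bsub>A\<^esub>i\<in>I. g i)"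
      using insert.hyps g by (simp add: mod_homD(2)[OF assms(3)])
    also have "\<dots> = (\<Oplus>\<^bsub>B\<^esub>i\<in>insert i I. f (g i))"
      using insert.hyps fg insert.IH[OF g(2)] by simp
    finally show ?case .
  qed
qed

lemma mod_hom_image_submodule:
  assumes "module R A" "module R B" "f \<in> mod_homs R A B" "submodule N R A"
  shows "submodule (f ` N) R B"
proof -
  interpret module_pair R A B using assms(1,2) by (simp add: module_pair_def)
  have N: "N \<subseteq> carrier A" by (rule A.submoduleE(1)[OF assms(4)])
  have smult: "r \<odot>\<^bsub>B\<^esub> y \<in> f ` N" if r: "r \<in> carrier R" and y: "y \<in> f ` N" for r y
  proof -
    obtain x where x: "x \<in> N" "y = f x" using y by auto
    then have "r \<odot>\<^bsub>B\<^esub> y = f (r \<odot>\<^bsub>A\<^esub> x)" using mod_homD(3)[OF assms(3) r] N by auto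
    then show ?thesis using A.submoduleE(4)[OF assms(4) r x(1)] by simp
  qed
  show ?thesis
  proof (rule B.submoduleI)
    show sub: "f ` N \<subseteq> carrier B" using mod_homD(1)[OF assms(3)] N by auto
    have "\<zero>\<^bsub>A\<^esub> \<in> N" using subgroup.one_closed[OF submodule.axioms(1)[OF assms(4)]] by simp
    then show "\<zero>\<^bsub>B\<^esub> \<in> f ` N" using mod_hom_zero[OF assms(1-3)] by (metis image_eqI)
    show "\<ominus>\<^bsub>B\<^esub> y \<in> f ` N" if y: "y \<in> f ` N" for y
    proof -
      have "(\<ominus>\<^bsub>R\<^esub> \<one>\<^bsub>R\<^esub>) \<odot>\<^bsub>B\<^esub> y = \<ominus>\<^bsub>B\<^esub> y"
        using B.smult_l_minus[of "\<one>\<^bsub>R\<^esub>" y] y sub by auto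
      then show ?thesis using smult[OF _ y, of "\<ominus>\<^bsub>R\<^esub> \<one>\<^bsub>R\<^esub>"] by simp
    qed
    show "y \<oplus>\<^bsub>B\<^esub> y' \<in> f ` N" if yy: "y \<in> f ` N" "y' \<in> f ` N" for y y'
    proof -
      obtain x x' where x: "x \<in> N" "y = f x" "x' \<in> N" "y' = f x'" using yy by auto
      then have "y \<oplus>\<^bsub>B\<^esub> y' = f (x \<oplus>\<^bsub>A\<^esub> x')" using mod_homD(2)[OF assms(3) subsetD[OF N x(1)] subsetD[OF N x(3)]] by simp
      then show ?thesis using A.submoduleE(5)[OF assms(4) x(1,3)] by simp
    qed
  qed (rule smult)
qed

text \<open>Relations on different finite sets are extended by zero to a common finite set.\<close>

lemma enumerate_relations:
  fixes T :: "('a, 't, 'c) module_scheme" and R :: "('a, 'b) ring_scheme"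
  assumes T: "module R T" and F: "finite F" "F \<subseteq> linear_relations R T" and s: "s \<in> carrier T"
  shows "\<exists>S (l :: nat) \<alpha>. finite S \<and> S \<subseteq> carrier T \<and> s \<in> S \<and>
    (\<forall>i<l. \<forall>t\<in>S. \<alpha> i t \<in> carrier R) \<and>
    (\<forall>i<l. (\<Oplus>\<^bsub>T\<^esub>t\<in>S. \<alpha> i t \<odot>\<^bsub>T\<^esub> t) = \<zero>\<^bsub>T\<^esub>) \<and>
    (\<forall>x \<in> carrier T \<rightarrow> carrier R. (\<forall>i<l. (\<Oplus>\<^bsub>R\<^esub>t\<in>S. \<alpha> i t \<otimes>\<^bsub>R\<^esub> x t) = \<zero>\<^bsub>R\<^esub>) \<longrightarrow>
      (\<forall>(B, a)\<in>F. (\<Oplus>\<^bsub>R\<^esub>t\<in>B. a t \<otimes>\<^bsub>R\<^esub> x t) = \<zero>\<^bsub>R\<^esub>))"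
proof -
  interpret T: module R T by (rule T)
  obtain L where L: "set L = F" using finite_list[OF F(1)] by auto
  define S where "S = insert s (\<Union>(fst ` F))"
  define \<alpha> where "\<alpha> i t = (if t \<in> fst (L ! i) then snd (L ! i) t else \<zero>\<^bsub>R\<^esub>)" for i t
  have rel: "finite B \<and> B \<subseteq> carrier T \<and> a \<in> B \<rightarrow> carrier R \<and> (\<Oplus>\<^bsub>T\<^esub>t\<in>B. a t \<odot>\<^bsub>T\<^esub> t) = \<zero>\<^bsub>T\<^esub>"
    if "(B, a) \<in> F" for B a
    using subsetD[OF F(2) that] unfolding linear_relations_def by simp
  have SF: "finite S" "S \<subseteq> carrier T" "s \<in> S"
    unfolding S_def using F(1) s rel by (force, force, simp)
  have nth: "(fst (L ! i), snd (L ! i)) \<in> F" if "i < length L" for i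
    using that L nth_mem by fastforce
  have sub: "B \<subseteq> S" if "(B, a) \<in> F" for B a using that unfolding S_def by force
  have \<alpha>R: "\<alpha> i t \<in> carrier R" if "i < length L" for i t
    using rel[OF nth[OF that]] unfolding \<alpha>_def by (auto simp: Pi_iff)
  have relT: "(\<Oplus>\<^bsub>T\<^esub>t\<in>S. \<alpha> i t \<odot>\<^bsub>T\<^esub> t) = \<zero>\<^bsub>T\<^esub>" if i: "i < length L" for i
  proof -
    have "(\<Oplus>\<^bsub>T\<^esub>t\<in>fst (L ! i). snd (L ! i) t \<odot>\<^bsub>T\<^esub> t) = (\<Oplus>\<^bsub>T\<^esub>t\<in>S. \<alpha> i t \<odot>\<^bsub>T\<^esub> t)"
    proof (rule T.M.add.finprod_mono_neutral_cong_left[OF SF(1) sub[OF nth[OF i]]])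
      show "\<alpha> i t \<odot>\<^bsub>T\<^esub> t = \<zero>\<^bsub>T\<^esub>" if "t \<in> S - fst (L ! i)" for t
        using that SF(2) unfolding \<alpha>_def by auto
      show "(\<lambda>t. \<alpha> i t \<odot>\<^bsub>T\<^esub> t) \<in> S \<rightarrow> carrier T" using \<alpha>R[OF i] SF(2) by auto
    qed (simp add: \<alpha>_def)
    then show ?thesis using rel[OF nth[OF i]] by simp
  qed
  have solF: "(\<Oplus>\<^bsub>R\<^esub>t\<in>B. a t \<otimes>\<^bsub>R\<^esub> x t) = \<zero>\<^bsub>R\<^esub>"
    if x: "x \<in> carrier T \<rightarrow> carrier R" and zero: "\<forall>i<length L. (\<Oplus>\<^bsub>R\<^esub>t\<in>S. \<alpha> i t \<otimes>\<^bsub>R\<^esub> x t) = \<zero>\<^bsub>R\<^esub>"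
      and Ba: "(B, a) \<in> F" for x B a
  proof -
    obtain i where i: "i < length L" "L ! i = (B, a)"
      using Ba L by (metis in_set_conv_nth)
    have xR: "x t \<in> carrier R" if "t \<in> S" for t using x SF(2) that by auto
    have "(\<Oplus>\<^bsub>R\<^esub>t\<in>B. a t \<otimes>\<^bsub>R\<^esub> x t) = (\<Oplus>\<^bsub>R\<^esub>t\<in>S. \<alpha> i t \<otimes>\<^bsub>R\<^esub> x t)"
    proof (rule T.R.add.finprod_mono_neutral_cong_left[OF SF(1) sub[OF Ba]])
      show "\<alpha> i t \<otimes>\<^bsub>R\<^esub> x t = \<zero>\<^bsub>R\<^esub>" if "t \<in> S - B" for t
        using that xR i(2) unfolding \<alpha>_def by auto
      show "(\<lambda>t. \<alpha> i t \<otimes>\<^bsub>R\<^esub> x t) \<in> S \<rightarrow> carrier R" using \<alpha>R[OF i(1)] xR by auto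
    qed (simp add: \<alpha>_def i(2))
    then show ?thesis using zero i(1) by simp
  qed
  show ?thesis
  proof (intro exI[of _ S] exI[of _ "length L"] exI[of _ \<alpha>] conjI SF)
    show "\<forall>i<length L. \<forall>t\<in>S. \<alpha> i t \<in> carrier R" using \<alpha>R by simp
    show "\<forall>i<length L. (\<Oplus>\<^bsub>T\<^esub>t\<in>S. \<alpha> i t \<odot>\<^bsub>T\<^esub> t) = \<zero>\<^bsub>T\<^esub>" using relT by simp
    show "\<forall>x \<in> carrier T \<rightarrow> carrier R. (\<forall>i<length L. (\<Oplus>\<^bsub>R\<^esub>t\<in>S. \<alpha> i t \<otimes>\<^bsub>R\<^esub> x t) = \<zero>\<^bsub>R\<^esub>) \<longrightarrow>
        (\<forall>(B, a)\<in>F. (\<Oplus>\<^bsub>R\<^esub>t\<in>B. a t \<otimes>\<^bsub>R\<^esub> x t) = \<zero>\<^bsub>R\<^esub>)"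
    proof (intro ballI impI)
      fix x p assume x: "x \<in> carrier T \<rightarrow> carrier R"
          "\<forall>i<length L. (\<Oplus>\<^bsub>R\<^esub>t\<in>S. \<alpha> i t \<otimes>\<^bsub>R\<^esub> x t) = \<zero>\<^bsub>R\<^esub>" and p: "p \<in> F"
      obtain B a where "p = (B, a)" by (rule prod.exhaust)
      then show "case p of (B, a) \<Rightarrow> (\<Oplus>\<^bsub>R\<^esub>t\<in>B. a t \<otimes>\<^bsub>R\<^esub> x t) = \<zero>\<^bsub>R\<^esub>"
        using solF[OF x, of B a] p by simp
    qed
  qed
qed

lemma module_colon_ideal:
  assumes M: "module R M" and N: "submodule N R M" and L: "L \<subseteq> carrier M"
  shows "ideal (module_colon R M N L) R"
proof -
  interpret M: module R M by (rule M)
  note E = M.submoduleE[OF N]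
  have Lc: "u \<in> carrier M" if "u \<in> L" for u using L that by auto
  show ?thesis
  proof (rule idealI[OF M.R.ring_axioms])
    show "subgroup (module_colon R M N L) (add_monoid R)"
    proof (rule M.R.add.subgroupI)
      show "module_colon R M N L \<subseteq> carrier R" unfolding module_colon_def by auto
      have "\<zero>\<^bsub>M\<^esub> \<in> N" using subgroup.one_closed[OF submodule.axioms(1)[OF N]] by simp
      then have "\<zero>\<^bsub>R\<^esub> \<in> module_colon R M N L" unfolding module_colon_def using Lc by simp
      then show "module_colon R M N L \<noteq> {}" by auto
      show "\<ominus>\<^bsub>R\<^esub> a \<in> module_colon R M N L" if "a \<in> module_colon R M N L" for a
        using that E(3) Lc unfolding module_colon_def by (simp add: M.smult_l_minus)
      show "a \<oplus>\<^bsub>R\<^esub> b \<in> module_colon R M N L"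
        if "a \<in> module_colon R M N L" "b \<in> module_colon R M N L" for a b
        using that E(5) Lc unfolding module_colon_def by (simp add: M.smult_l_distr)
    qed
  next
    fix a x assume a: "a \<in> module_colon R M N L" and x: "x \<in> carrier R"
    then show "x \<otimes>\<^bsub>R\<^esub> a \<in> module_colon R M N L"
      using E(4) Lc unfolding module_colon_def by (simp add: M.smult_assoc1)
    then show "a \<otimes>\<^bsub>R\<^esub> x \<in> module_colon R M N L"
      using a x M.R.m_comm unfolding module_colon_def by simp
  qed
qed

lemma almost_trace_subset_test_ideal:
  fixes T :: "('a, 't) module" and R :: "'a ring"
  assumes T: "algebra R T" and \<rho>: "\<And>n. \<rho> n \<in> carrier T"
  shows "almost_trace R T \<rho> \<subseteq> test_ideal R (almost_closure R T \<rho> :: ('a, 'm) module \<Rightarrow> 'm set \<Rightarrow> 'm set)"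
proof -
  interpret T: algebra R T by (rule T)
  have "almost_trace R T \<rho> \<subseteq> module_colon R M N (almost_closure R T \<rho> M N)"
    if M: "module R M" and N: "submodule N R M" for M :: "('a, 'm) module" and N
    unfolding almost_trace_def
  proof (rule T.R.genideal_minimal)
    show "ideal (module_colon R M N (almost_closure R T \<rho> M N)) R"
      by (rule module_colon_ideal[OF M N]) (auto simp: almost_closure_def)
    show "(\<Union>n\<in>{0<..}. \<Union>\<psi>\<in>mod_homs R T (self_module R). \<psi> ` (\<lambda>t. \<rho> n \<otimes>\<^bsub>T\<^esub> t) ` carrier T)
        \<subseteq> module_colon R M N (almost_closure R T \<rho> M N)"
      unfolding image_image
    proof (intro UN_least image_subsetI)
      fix n :: nat and \<psi> t assume n: "n \<in> {0<..}" and \<psi>: "\<psi> \<in> mod_homs R T (self_module R)" and t: "t \<in> carrier T"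
      \<comment> \<open>Multiplication by \<open>t\<close> is absorbed into the homomorphism.\<close>
      define \<phi> where "\<phi> x = \<psi> (x \<otimes>\<^bsub>T\<^esub> t)" for x
      have \<phi>: "\<phi> \<in> mod_homs R T (self_module R)"
        using \<psi> t unfolding mod_homs_def \<phi>_def
        by (auto simp: Pi_iff T.l_distr T.smult_assoc2)
      have "\<phi> (\<rho> n) \<in> carrier R"
        using mod_homD(1)[OF \<phi> \<rho>] by (simp add: self_module_def)
      moreover have "\<phi> (\<rho> n) \<odot>\<^bsub>M\<^esub> u \<in> N" if u: "u \<in> almost_closure R T \<rho> M N" for u
        using u n unfolding almost_closure_def
        by (intro functional_contracts_image[OF T.module M N \<phi> \<rho>]) auto
      ultimately show "\<psi> (\<rho> n \<otimes>\<^bsub>T\<^esub> t) \<in> module_colon R M N (almost_closure R T \<rho> M N)"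
        unfolding module_colon_def \<phi>_def by simp
    qed
  qed
  then show ?thesis unfolding test_ideal_def by (intro Inter_greatest) auto
qed

text \<open>An element \<open>u\<close> of the closure of \<open>N\<close> all of whose multipliers into \<open>N\<close> lie in \<open>Q\<close>. For each \<open>n\<close>
  there is a finite set of relations of \<open>T\<close> forcing the value at \<open>\<rho> n\<close> into \<open>Q\<close>. In the module built
  from these relations \<open>u = e\<^sub>0\<close> is minus the column of \<open>\<rho> n\<close> modulo \<open>N\<close> for every \<open>n\<close>, which puts
  \<open>\<rho> n \<otimes> u\<close> into the image of \<open>T \<otimes> N\<close>.\<close>

lemma separating_module:
  fixes R :: "'a ring" (structure) and T :: "('a, 't) module" and \<iota> :: "'a \<Rightarrow> 'm"
  assumes R: "complete_local_ring R \<mm>" "infinite (carrier R)" and \<iota>: "inj_on \<iota> (carrier R)"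
    and T: "module R T" and \<rho>: "\<And>n. \<rho> n \<in> carrier T"
    and Q: "ideal Q R" "noetherian_local_ring.adic_power R \<mm> k \<subseteq> Q"
    and homs: "\<And>n \<psi>. n > 0 \<Longrightarrow> \<psi> \<in> mod_homs R T (self_module R) \<Longrightarrow> \<psi> (\<rho> n) \<in> Q"
  obtains M :: "('a, 'm) module" and N u where "module R M" "submodule N R M"
    and "u \<in> almost_closure R T \<rho> M N" "\<And>r. r \<in> carrier R \<Longrightarrow> r \<odot>\<^bsub>M\<^esub> u \<in> N \<Longrightarrow> r \<in> Q"
proof -
  interpret complete_local_ring R \<mm> by (rule R(1))
  \<comment> \<open>The closure concerns the roots with positive index only.\<close>
  define s where "s n = \<rho> (Suc n)" for n
  define good where "good n S l \<alpha> \<longleftrightarrow> finite S \<and> S \<subseteq> carrier T \<and> s n \<in> S \<and>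
    (\<forall>i<l. \<forall>t\<in>S. \<alpha> i t \<in> carrier R) \<and>
    (\<forall>i<l. (\<Oplus>\<^bsub>T\<^esub>t\<in>S. \<alpha> i t \<odot>\<^bsub>T\<^esub> t) = \<zero>\<^bsub>T\<^esub>) \<and>
    (\<forall>x \<in> carrier T \<rightarrow> carrier R. (\<forall>i<l. (\<Oplus>t\<in>S. \<alpha> i t \<otimes> x t) = \<zero>) \<longrightarrow> x (s n) \<in> Q)"
    for n S and l :: nat and \<alpha>
  have "\<exists>S l \<alpha>. good n S l \<alpha>" for n
  proof -
    have sT: "s n \<in> carrier T" unfolding s_def by (rule \<rho>)
    have "\<forall>\<psi>\<in>mod_homs R T (self_module R). \<psi> (s n) \<in> Q"
      unfolding s_def using homs by simp
    from finite_obstruction[OF T sT Q this]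
    obtain F where F: "finite F" "F \<subseteq> linear_relations R T"
      and obs: "\<forall>x \<in> carrier T \<rightarrow> carrier R. (\<forall>(S, a)\<in>F. (\<Oplus>t\<in>S. a t \<otimes> x t) = \<zero>) \<longrightarrow> x (s n) \<in> Q"
      by (elim exE conjE)
    from enumerate_relations[OF T F sT] obtain S and l :: nat and \<alpha> where
      S: "finite S" "S \<subseteq> carrier T" "s n \<in> S" "\<forall>i<l. \<forall>t\<in>S. \<alpha> i t \<in> carrier R"
        "\<forall>i<l. (\<Oplus>\<^bsub>T\<^esub>t\<in>S. \<alpha> i t \<odot>\<^bsub>T\<^esub> t) = \<zero>\<^bsub>T\<^esub>"
      and sol: "\<forall>x \<in> carrier T \<rightarrow> carrier R. (\<forall>i<l. (\<Oplus>t\<in>S. \<alpha> i t \<otimes> x t) = \<zero>) \<longrightarrow>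
        (\<forall>(B, a)\<in>F. (\<Oplus>t\<in>B. a t \<otimes> x t) = \<zero>)"
      by (elim exE conjE)
    have "x (s n) \<in> Q" if x: "x \<in> carrier T \<rightarrow> carrier R" "\<forall>i<l. (\<Oplus>t\<in>S. \<alpha> i t \<otimes> x t) = \<zero>" for x
      using mp[OF bspec[OF obs x(1)] mp[OF bspec[OF sol x(1)] x(2)]] .
    then have "good n S l \<alpha>" unfolding good_def using S by (intro conjI ballI impI)
    then show ?thesis by (intro exI)
  qed
  then obtain S l \<alpha> where good: "\<And>n. good n (S n) (l n) (\<alpha> n)" by metis
  interpret sys: relation_systems R "carrier T" S l \<alpha> s
    by unfold_locales (use good in \<open>simp_all add: good_def\<close>)
  let ?P = "UP R"
  obtain g :: "(nat \<Rightarrow> 'a) \<Rightarrow> 'a" where g: "inj_on g (carrier ?P)" "g ` carrier ?P \<subseteq> carrier R"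
    using polynomials_inject[OF R(2)] by metis
  define h where "h = \<iota> \<circ> g"
  have h_inj: "inj_on h (carrier ?P)"
    unfolding h_def using g(1) inj_on_subset[OF \<iota> g(2)] by (rule comp_inj_on)
  obtain M :: "('a, 'm) module" where M: "module R M" "carrier M = h ` carrier ?P" "h \<in> mod_homs R ?P M"
    using transport_module[OF sys.P_module h_inj] by metis
  define N where "N = h ` sys.image_module"
  have N: "submodule N R M"
    unfolding N_def by (rule mod_hom_image_submodule[OF sys.P_module M(1,3) sys.image_module_submodule])
  define u where "u = h (sys.unit_vec 0)"
  have u: "u \<in> carrier M" unfolding u_def M(2) by simp
  have "pure_tensor R T M (s n) u \<in> tensor_map R T M id id ` carrier (tensor_product R T (M\<lparr>carrier := N\<rparr>))" for n
  proof (rule relations_imp_in_image[OF T M(1) N _ _ _ finite_lessThan[of "l n"] _ _ u])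
    show "finite (S n)" "S n \<subseteq> carrier T" "s n \<in> S n" by (rule sys.S)+
    show "\<alpha> n i t \<in> carrier R" if "i \<in> {..<l n}" "t \<in> S n" for i t
      using that by (intro sys.\<alpha>) simp_all
    show "h (sys.unit_vec (relation_index n i)) \<in> carrier M" if "i \<in> {..<l n}" for i
      unfolding M(2) by simp
    show "(\<Oplus>\<^bsub>T\<^esub>t\<in>S n. \<alpha> n i t \<odot>\<^bsub>T\<^esub> t) = \<zero>\<^bsub>T\<^esub>" if "i \<in> {..<l n}" for i
      using good[of n] that unfolding good_def by simp
    fix t assume t: "t \<in> S n"
    let ?e = "if t = s n then sys.unit_vec 0 else \<zero>\<^bsub>?P\<^esub>"
    let ?f = "\<lambda>i. \<alpha> n i t \<odot>\<^bsub>?P\<^esub> sys.unit_vec (relation_index n i)"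
    interpret M: module R M by (rule M(1))
    have f: "?f \<in> {..<l n} \<rightarrow> carrier ?P" using sys.\<alpha>[OF _ t] by simp
    have "h (?e \<oplus>\<^bsub>?P\<^esub> (\<Oplus>\<^bsub>?P\<^esub>i\<in>{..<l n}. ?f i)) = h ?e \<oplus>\<^bsub>M\<^esub> h (\<Oplus>\<^bsub>?P\<^esub>i\<in>{..<l n}. ?f i)"
      using f by (intro mod_homD(2)[OF M(3)] sys.P.P.finsum_closed) simp_all
    also have "h ?e = (if t = s n then u else \<zero>\<^bsub>M\<^esub>)"
      using mod_hom_zero[OF sys.P_module M(1,3)] by (simp add: u_def)
    also have "h (\<Oplus>\<^bsub>?P\<^esub>i\<in>{..<l n}. ?f i) = (\<Oplus>\<^bsub>M\<^esub>i\<in>{..<l n}. h (?f i))"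
      by (rule mod_hom_finsum[OF sys.P_module M(1,3) finite_lessThan f])
    also have "\<dots> = (\<Oplus>\<^bsub>M\<^esub>i\<in>{..<l n}. \<alpha> n i t \<odot>\<^bsub>M\<^esub> h (sys.unit_vec (relation_index n i)))"
      using sys.\<alpha>[OF _ t] mod_homD(1,3)[OF M(3)] by (intro M.finsum_cong') simp_all
    finally show "(if t = s n then u else \<zero>\<^bsub>M\<^esub>) \<oplus>\<^bsub>M\<^esub>
        (\<Oplus>\<^bsub>M\<^esub>i\<in>{..<l n}. \<alpha> n i t \<odot>\<^bsub>M\<^esub> h (sys.unit_vec (relation_index n i))) \<in> N"
      using imageI[OF sys.column_in_image_module[OF t], of h] unfolding N_def by simp
  qed
  then have "pure_tensor R T M (\<rho> n) u \<in> tensor_map R T M id id ` carrier (tensor_product R T (M\<lparr>carrier := N\<rparr>))"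
    if "n > 0" for n
    using gr0_implies_Suc[OF that] unfolding s_def by (elim exE) simp
  then have "u \<in> almost_closure R T \<rho> M N" unfolding almost_closure_def using u by simp
  moreover have "r \<in> Q" if r: "r \<in> carrier R" "r \<odot>\<^bsub>M\<^esub> u \<in> N" for r
  proof (rule sys.multiple_of_zeroth_unit_vec[OF Q(1) _ r(1)])
    show "x (s n) \<in> Q" if "x \<in> carrier T \<rightarrow> carrier R" "\<And>i. i < l n \<Longrightarrow> sys.lin n i x = \<zero>" for n x
      using good[of n] that unfolding good_def sys.lin_def by simp
    have "h (r \<odot>\<^bsub>?P\<^esub> sys.unit_vec 0) \<in> h ` sys.image_module"
      using r mod_homD(3)[OF M(3) r(1)] unfolding u_def N_def by simp
    then obtain v where v: "v \<in> sys.image_module" "h (r \<odot>\<^bsub>?P\<^esub> sys.unit_vec 0) = h v"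
      by (elim imageE)
    have "v \<in> carrier ?P" using v(1) unfolding sys.image_module_def by simp
    moreover have "r \<odot>\<^bsub>?P\<^esub> sys.unit_vec 0 \<in> carrier ?P" using r(1) by simp
    ultimately have "r \<odot>\<^bsub>?P\<^esub> sys.unit_vec 0 = v"
      using v(2) h_inj unfolding inj_on_def by simp
    then show "r \<odot>\<^bsub>?P\<^esub> sys.unit_vec 0 \<in> sys.image_module" using v(1) by simp
  qed
  ultimately show thesis using that[OF M(1) N] by simp
qed

text \<open>An element outside the trace ideal \<open>I\<close> is outside \<open>I + \<mm>\<^sup>k\<close> for some \<open>k\<close>, and this open ideal
  contains all values of homomorphisms at the roots, so that the previous lemma applies.\<close>

lemma test_ideal_subset_almost_trace:
  fixes R :: "'a ring" (structure) and T :: "('a, 't) module" and \<iota> :: "'a \<Rightarrow> 'm"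
  assumes R: "complete_local_ring R \<mm>" "infinite (carrier R)" and \<iota>: "inj_on \<iota> (carrier R)"
    and T: "algebra R T" and \<rho>: "\<And>n. \<rho> n \<in> carrier T"
  shows "test_ideal R (almost_closure R T \<rho> :: ('a, 'm) module \<Rightarrow> 'm set \<Rightarrow> 'm set) \<subseteq> almost_trace R T \<rho>"
proof
  fix r assume r: "r \<in> test_ideal R (almost_closure R T \<rho> :: ('a, 'm) module \<Rightarrow> 'm set \<Rightarrow> 'm set)"
  interpret complete_local_ring R \<mm> by (rule R(1))
  interpret T: algebra R T by (rule T)
  have in_colon: "r \<in> module_colon R M N (almost_closure R T \<rho> M N)"
    if "module R M" "submodule N R M" for M :: "('a, 'm) module" and N
    using r that unfolding test_ideal_def by auto
  let ?G = "\<Union>n\<in>{0<..}. \<Union>\<psi>\<in>mod_homs R T (self_module R). \<psi> ` (\<lambda>t. \<rho> n \<otimes>\<^bsub>T\<^esub> t) ` carrier T"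
  have G: "?G \<subseteq> carrier R"
    unfolding image_image
  proof (intro UN_least image_subsetI)
    fix \<psi> n t assume \<psi>: "\<psi> \<in> mod_homs R T (self_module R)" and t: "t \<in> carrier T"
    have "\<rho> n \<otimes>\<^bsub>T\<^esub> t \<in> carrier T" using \<rho> t by simp
    from mod_homD(1)[OF \<psi> this] show "\<psi> (\<rho> n \<otimes>\<^bsub>T\<^esub> t) \<in> carrier R" by (simp add: self_module_def)
  qed
  have I: "ideal (almost_trace R T \<rho>) R"
    unfolding almost_trace_def by (rule genideal_ideal[OF G])
  have value_in: "\<psi> (\<rho> n) \<in> almost_trace R T \<rho>" if "n > 0" "\<psi> \<in> mod_homs R T (self_module R)" for n \<psi>
  proof -
    have "\<psi> (\<rho> n \<otimes>\<^bsub>T\<^esub> \<one>\<^bsub>T\<^esub>) \<in> ?G" using that T.one_closed by blast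
    from subsetD[OF genideal_self[OF G] this] show ?thesis
      using \<rho>[of n] unfolding almost_trace_def by simp
  qed
  show "r \<in> almost_trace R T \<rho>"
  proof (rule ccontr)
    assume not: "r \<notin> almost_trace R T \<rho>"
    have rR: "r \<in> carrier R"
    proof -
      \<comment> \<open>There is at least one module in the given type, so the intersection is contained in \<open>R\<close>.\<close>
      have in_R: "\<psi> (\<rho> n) \<in> carrier R" if "\<psi> \<in> mod_homs R T (self_module R)" for \<psi> n
        using mod_homD(1)[OF that, of "\<rho> n"] \<rho> by (simp add: self_module_def)
      obtain M :: "('a, 'm) module" and N where "module R M" "submodule N R M"
        by (rule separating_module[where \<rho> = \<rho> and k = 0 and thesis = thesis, OF R \<iota> T.module \<rho> oneideal])
          (simp_all add: adic_power_0 in_R)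
      then show ?thesis using in_colon unfolding module_colon_def by auto
    qed
    from krull_closed[OF I rR not] obtain k where k: "r \<notin> almost_trace R T \<rho> <+> adic_power k"
      by (elim exE)
    let ?Q = "almost_trace R T \<rho> <+> adic_power k"
    have Q: "ideal ?Q R" by (rule add_ideals[OF I adic_power_ideal])
    note sub = add_ideal_upper[OF I adic_power_ideal[of k]]
    obtain M :: "('a, 'm) module" and N u where M: "module R M" "submodule N R M"
      and u: "u \<in> almost_closure R T \<rho> M N" "\<And>r. r \<in> carrier R \<Longrightarrow> r \<odot>\<^bsub>M\<^esub> u \<in> N \<Longrightarrow> r \<in> ?Q"
      by (rule separating_module[where \<rho> = \<rho> and thesis = thesis, OF R \<iota> T.module \<rho> Q sub(2)])
        (use value_in sub(1) in auto)
    have "r \<odot>\<^bsub>M\<^esub> u \<in> N" using in_colon[OF M] u(1) unfolding module_colon_def by simp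
    then show False using u(2)[OF rR] k by simp
  qed
qed

theorem theorem6p5:
  fixes R :: "'a ring" and \<mm> :: "'a set" and p d :: nat
    and T :: "('a, 't) module" and \<pi> :: 't and \<rho> :: "nat \<Rightarrow> 't"
  assumes "noetherian_domain R" and "local_ring R \<mm>" and "adically_complete R \<mm>"
    and "krull_dim R = enat d" and "d > 0"
    and "mixed_char R \<mm> p"
    and "algebra R T" and "p_torsion_free T p"
    and "nonzerodivisor T \<pi>" and "compatible_roots T p \<pi> \<rho>"
    and "almost_big_CM R \<mm> T \<rho>"
    \<comment> \<open>The type \<open>'m\<close> of elements of the modules in the test ideal is arbitrary, but at least as
      large as \<open>R\<close>: for too small a type the intersection would miss modules.\<close>
    and "\<exists>\<iota> :: 'a \<Rightarrow> 'm. inj_on \<iota> (carrier R)"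
  shows "test_ideal R (almost_closure R T \<rho> :: ('a, 'm) module \<Rightarrow> 'm set \<Rightarrow> 'm set)
       = almost_trace R T \<rho>"
proof (rule equalityI)
  have \<rho>: "\<rho> n \<in> carrier T" for n
    using assms(10) by (simp add: compatible_roots_def)
  have local: "cring R" "maximalideal \<mm> R" "\<And>J. maximalideal J R \<Longrightarrow> J = \<mm>"
    using assms(2) unfolding local_ring_def by simp_all
  have "noetherian_ring R" using assms(1) by (simp add: noetherian_domain_def)
  then have complete: "complete_local_ring R \<mm>"
    using local assms(3) noetherian_local_ring.intro noetherian_local_ring_axioms.intro
      complete_local_ring.intro complete_local_ring_axioms.intro by metis
  have "has_char R 0" using assms(6) by (simp add: mixed_char_def)
  then have infinite: "infinite (carrier R)"
    using ring.char_zero_infinite[OF cring.axioms(1)[OF local(1)]] by simp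
  obtain \<iota> :: "'a \<Rightarrow> 'm" where "inj_on \<iota> (carrier R)" using assms(12) by (elim exE)
  from test_ideal_subset_almost_trace[OF complete infinite this assms(7) \<rho>]
  show "test_ideal R (almost_closure R T \<rho> :: ('a, 'm) module \<Rightarrow> 'm set \<Rightarrow> 'm set) \<subseteq> almost_trace R T \<rho>" .
  show "almost_trace R T \<rho> \<subseteq> test_ideal R (almost_closure R T \<rho> :: ('a, 'm) module \<Rightarrow> 'm set \<Rightarrow> 'm set)"
    by (rule almost_trace_subset_test_ideal[OF assms(7) \<rho>])
qed

end
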